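(* Let $\mathscr{C}=(S,V_1,V_2,\Pi_1,\Pi_2,\langle\ ,\ \rangle)$ be a Coxeter datum. For each $\alpha\in\Phi_1(\mathscr{C})$ and each $r\in S$, $$\mathrm{coeff}_r(\alpha)\,\mathrm{coeff}_r(\phi(\alpha))\ \ge\ (\mathrm{coeff}_r(\phi_1(\alpha)))^2.$$
   Context: **Coxeter datum.** Let $S$ be an arbitrary set in which each unordered pair $\{s,t\}$ of elements is assigned an $m_{st}\in\mathbb{Z}\cup\{\infty\}$ with $m_{ss}=1$ for all $s\in S$ and $m_{st}\ge 2$ for all distinct $s,t\in S$. For a subset $A$ of a real vector space, $\mathrm{PLC}(A)=\{\sum_{a\in A}\lambda_a a\mid \lambda_a\ge 0 \text{ for all } a\in A, \text{ and } \lambda_{a'}>0\text{ for some }a'\in A\}$ (finite sums). A Coxeter datum with Coxeter parameters $m_{st}$ is a tuple $\mathscr{C}=(S,V_1,V_2,\Pi_1,\Pi_2,\langle\ ,\ \rangle)$ where $V_1,V_2$ are real vector spaces, $\langle\ ,\ \rangle\colon V_1\times V_2\to\mathbb{R}$ is bilinear, $\Pi_1=\{\alpha_s\mid s\in S\}\subseteq V_1$ and $\Pi_2=\{\beta_s\mid s\in S\}\subseteq V_2$, such that: (C1) $\langle\alpha_s,\beta_s\rangle=1$ for all $s\in S$; (C2) $\langle\alpha_s,\beta_t\rangle\le 0$ for all distinct $s,t\in S$; (C3) for all $s,t\in S$, $\langle\alpha_s,\beta_t\rangle\langle\alpha_t,\beta_s\rangle=\cos^2(\pi/m_{st})$ if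 $m_{st}\ne\infty$, and equals $\gamma^2$ for some $\gamma\ge1$ (depending on $s,t$) if $m_{st}=\infty$; (C4) $\langle\alpha_s,\beta_t\rangle=0$ if and only if $\langle\alpha_t,\beta_s\rangle=0$, for all $s,t\in S$; (C5) $0\notin\mathrm{PLC}(\Pi_1)$ and $0\notin\mathrm{PLC}(\Pi_2)$, in the sense that $\sum_{s\in S}\lambda_s\alpha_s=0$ with all $\lambda_s\ge0$ implies all $\lambda_s=0$, and likewise for the $\beta_s$. Linear independence of $\Pi_1,\Pi_2$ is not assumed. **Action and roots.** $(W,R)$, $R=\{r_s\mid s\in S\}$, is the abstract Coxeter system with parameters $m_{st}$ (relations $r_s^2=1$, $(r_sr_t)^{m_{st}}=1$ for $m_{st}\neq\infty$). $W$ acts on $V_1,V_2$ by $r_sx=x-2\langle x,\beta_s\rangle\alpha_s$ and $r_sy=y-2\langle\alpha_s,y\rangle\beta_s$. Put $\Phi_1(\mathscr{C})=W\Pi_1$, $\Phi_2(\mathscr{C})=W\Pi_2$. The map $\phi\colon\Phi_1(\mathscr{C})\to\Phi_2(\mathscr{C})$ is the (unique, well-defined) $W$-equivariant bijection with $\phi(\alpha_s)=\beta_s$ for all $s\in S$. **Canonical coefficients.** Let $V_1',V_2'$ be real vector spaces with bases $\{\alpha_s'\}_{s\in S}$, $\{\beta_s'\}_{s\in S}$ and bilinear map $\langle\alpha_s',\beta_t'\rangle'=\langle\alpha_s,\beta_t\rangle$; this is a Coxeter datum $\mathscr{C}'$ with the same parameters, so $W$ acts on $V_1',V_2'$ by the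 same formulas, with root systems $\Phi_i(\mathscr{C}')$. The linear maps $\pi_1\colon\alpha_s'\mapsto\alpha_s$ and $\pi_2\colon\beta_s'\mapsto\beta_s$ restrict to $W$-equivariant bijections $\Phi_i(\mathscr{C}')\to\Phi_i(\mathscr{C})$. For $z\in\Phi_1(\mathscr{C})$ (resp. $z\in\Phi_2(\mathscr{C})$), $\mathrm{coeff}_s(z)$ is the coefficient of $\alpha_s'$ (resp. $\beta_s'$) in the basis expansion of the unique root $z'\in\Phi_i(\mathscr{C}')$ with $\pi_i(z')=z$. **Standard geometric realization.** Let $V$ be a real vector space with basis $\{\gamma_s\mid s\in S\}$ and symmetric bilinear form $(\,,\,)$ with $(\gamma_s,\gamma_s)=1$ for all $s$, $(\gamma_s,\gamma_t)\le0$ for all $s\ne t$, and $(\gamma_s,\gamma_t)^2=\langle\alpha_s,\beta_t\rangle\langle\alpha_t,\beta_s\rangle$ for all $s,t$. $W$ acts on $V$ by $r_sv=v-2(v,\gamma_s)\gamma_s$; $\Phi=\{w\gamma_s\mid w\in W,s\in S\}$. For $\gamma\in\Phi$, $\mathrm{coeff}_s(\gamma)$ is the coefficient of $\gamma_s$ in $\gamma$. The map $\phi_1\colon\Phi_1(\mathscr{C})\to\Phi$ is the (well-defined) $W$-equivariant map with $\phi_1(\alpha_s)=\gamma_s$ for all $s\in S$. *)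

theory Defs
  imports "HOL-Analysis.Analysis" "HOL-Algebra.Group"
begin

section \<open>The abstract Coxeter group\<close>

text \<open>
  The index set \<open>S\<close> is the (arbitrary) type \<open>'s\<close>, and \<open>m\<^sub>s\<^sub>t = \<infinity>\<close> is allowed.
\<close>

definition coxeter_matrix :: "('s \<Rightarrow> 's \<Rightarrow> enat) \<Rightarrow> bool" where
  "coxeter_matrix m \<longleftrightarrow>
     (\<forall>s t. m s t = m t s) \<and> (\<forall>s. m s s = 1) \<and> (\<forall>s t. s \<noteq> t \<longrightarrow> 2 \<le> m s t)"

text \<open>
  The group presented by \<open>r\<^sub>s\<^sup>2 = 1\<close> and \<open>(r\<^sub>s r\<^sub>t)\<^sup>m = 1\<close> for \<open>m = m\<^sub>s\<^sub>t \<noteq> \<infinity>\<close>. As the generators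
  are involutions, no formal inverses are needed: the group is the free monoid of words
  over \<open>'s\<close> modulo the congruence generated by the relations.
\<close>

inductive coxeter_eq :: "('s \<Rightarrow> 's \<Rightarrow> enat) \<Rightarrow> 's list \<Rightarrow> 's list \<Rightarrow> bool"
  for m :: "'s \<Rightarrow> 's \<Rightarrow> enat" where
  refl: "coxeter_eq m u u"
| sym: "coxeter_eq m u v \<Longrightarrow> coxeter_eq m v u"
| trans: "coxeter_eq m u v \<Longrightarrow> coxeter_eq m v w \<Longrightarrow> coxeter_eq m u w"
| square: "coxeter_eq m (u @ [s, s] @ v) (u @ v)"
| order: "m s t = enat k \<Longrightarrow> coxeter_eq m (u @ concat (replicate k [s, t]) @ v) (u @ v)"

definition coxeter_rel :: "('s \<Rightarrow> 's \<Rightarrow> enat) \<Rightarrow> ('s list \<times> 's list) set" where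
  "coxeter_rel m = {(u, v). coxeter_eq m u v}"

definition coxeter_group :: "('s \<Rightarrow> 's \<Rightarrow> enat) \<Rightarrow> 's list set monoid" where
  "coxeter_group m =
     \<lparr>carrier = UNIV // coxeter_rel m,
      mult = (\<lambda>X Y. coxeter_rel m `` {u @ v | u v. u \<in> X \<and> v \<in> Y}),
      one = coxeter_rel m `` {[]}\<rparr>"

lemma equiv_coxeter_rel: "equiv UNIV (coxeter_rel m)"
  unfolding coxeter_rel_def
  by (intro equivI refl_onI symI transI)
     (auto intro: coxeter_eq.refl coxeter_eq.sym coxeter_eq.trans)

lemma coxeter_eq_context: "coxeter_eq m u v \<Longrightarrow> coxeter_eq m (p @ u @ q) (p @ v @ q)"
proof (induction rule: coxeter_eq.induct)
  case (square u s v)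
  show ?case using coxeter_eq.square[of m "p @ u" s "v @ q"] by simp
next
  case (order s t k u v)
  show ?case using coxeter_eq.order[of m s t k "p @ u" "v @ q"] order by simp
qed (auto intro: coxeter_eq.intros)

lemma coxeter_eq_append:
  assumes "coxeter_eq m u u'" "coxeter_eq m v v'"
  shows "coxeter_eq m (u @ v) (u' @ v')"
  using coxeter_eq_context[OF assms(1), of "[]" v] coxeter_eq_context[OF assms(2), of u' "[]"]
  by (auto intro: coxeter_eq.trans)

lemma coxeter_eq_rev: "coxeter_eq m (rev u @ u) []"
proof (induction u)
  case (Cons a u)
  have "coxeter_eq m (rev u @ [a, a] @ u) (rev u @ u)" by (rule coxeter_eq.square)
  then show ?case using Cons by (auto intro: coxeter_eq.trans)
qed (simp add: coxeter_eq.refl)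

lemma coxeter_mult_class:
  "coxeter_rel m `` {u} \<otimes>\<^bsub>coxeter_group m\<^esub> coxeter_rel m `` {v} = coxeter_rel m `` {u @ v}"
  unfolding coxeter_group_def coxeter_rel_def
  by (auto intro: coxeter_eq_append coxeter_eq.refl coxeter_eq.trans)

lemma group_coxeter_group: "group (coxeter_group m)"
proof -
  have carr: "X \<in> carrier (coxeter_group m) \<longleftrightarrow> (\<exists>u. X = coxeter_rel m `` {u})" for X
    by (auto simp: coxeter_group_def quotient_def)
  have one: "\<one>\<^bsub>coxeter_group m\<^esub> = coxeter_rel m `` {[]}"
    by (simp add: coxeter_group_def)
  have inv: "coxeter_rel m `` {rev u @ u} = coxeter_rel m `` {[]}" for u
    by (rule equiv_class_eq[OF equiv_coxeter_rel]) (simp add: coxeter_rel_def coxeter_eq_rev)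
  show ?thesis
  proof (rule groupI)
    fix X assume "X \<in> carrier (coxeter_group m)"
    then obtain u where "X = coxeter_rel m `` {u}" using carr by auto
    then show "\<exists>Y\<in>carrier (coxeter_group m). Y \<otimes>\<^bsub>coxeter_group m\<^esub> X = \<one>\<^bsub>coxeter_group m\<^esub>"
      using inv[of u] coxeter_mult_class[of m "rev u" u] carr one
      by (intro bexI[of _ "coxeter_rel m `` {rev u}"]) auto
  qed (auto simp: carr one coxeter_mult_class)
qed

text \<open>
  If every generator \<open>s\<close> acts on a set through \<open>f s\<close>, a word acts as the composite of its
  letters, and an element of the group acts as any word representing it. The set
  \<open>(\<lambda>u. foldr f u x) ` w\<close> is a singleton whenever the maps \<open>f s\<close> satisfy the defining relations.
\<close>

definition coxeter_act :: "('s \<Rightarrow> 'v \<Rightarrow> 'v) \<Rightarrow> 's list set \<Rightarrow> 'v \<Rightarrow> 'v" where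
  "coxeter_act f w x = the_elem ((\<lambda>u. foldr f u x) ` w)"

definition orbit_of_simple ::
    "('s \<Rightarrow> 's \<Rightarrow> enat) \<Rightarrow> ('s \<Rightarrow> 'v \<Rightarrow> 'v) \<Rightarrow> ('s \<Rightarrow> 'v) \<Rightarrow> 'v set" where
  "orbit_of_simple m f e =
     {coxeter_act f w (e s) | w s. w \<in> carrier (coxeter_group m)}"

section \<open>Coxeter data, their actions and root systems\<close>

text \<open>
  The sets \<open>\<Pi>\<^sub>1\<close>, \<open>\<Pi>\<^sub>2\<close> are given as families; the assumptions C1 and C2 force these to be injective.
  In C5 the sums are over finite parts of the index set.
\<close>

locale coxeter_datum =
  fixes m :: "'s \<Rightarrow> 's \<Rightarrow> enat"
    and \<alpha> :: "'s \<Rightarrow> 'a::real_vector"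
    and \<beta> :: "'s \<Rightarrow> 'b::real_vector"
    and B :: "'a \<Rightarrow> 'b \<Rightarrow> real"
  assumes matrix: "coxeter_matrix m"
    and bilinear: "bilinear B"
    and C1: "\<And>s. B (\<alpha> s) (\<beta> s) = 1"
    and C2: "\<And>s t. s \<noteq> t \<Longrightarrow> B (\<alpha> s) (\<beta> t) \<le> 0"
    and C3_finite: "\<And>s t k. m s t = enat k \<Longrightarrow>
          B (\<alpha> s) (\<beta> t) * B (\<alpha> t) (\<beta> s) = (cos (pi / real k))\<^sup>2"
    and C3_infinite: "\<And>s t. m s t = \<infinity> \<Longrightarrow>
          \<exists>c\<ge>1. B (\<alpha> s) (\<beta> t) * B (\<alpha> t) (\<beta> s) = c\<^sup>2"
    and C4: "\<And>s t. B (\<alpha> s) (\<beta> t) = 0 \<longleftrightarrow> B (\<alpha> t) (\<beta> s) = 0"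
    and C5_1: "\<And>F c. finite F \<Longrightarrow> (\<forall>s\<in>F. 0 \<le> c s) \<Longrightarrow>
          (\<Sum>s\<in>F. c s *\<^sub>R \<alpha> s) = 0 \<Longrightarrow> \<forall>s\<in>F. c s = 0"
    and C5_2: "\<And>F c. finite F \<Longrightarrow> (\<forall>s\<in>F. 0 \<le> c s) \<Longrightarrow>
          (\<Sum>s\<in>F. c s *\<^sub>R \<beta> s) = 0 \<Longrightarrow> \<forall>s\<in>F. c s = 0"

definition refl1 ::
    "('s \<Rightarrow> 'a::real_vector) \<Rightarrow> ('s \<Rightarrow> 'b::real_vector) \<Rightarrow> ('a \<Rightarrow> 'b \<Rightarrow> real) \<Rightarrow> 's \<Rightarrow> 'a \<Rightarrow> 'a" where
  "refl1 \<alpha> \<beta> B s x = x - (2 * B x (\<beta> s)) *\<^sub>R \<alpha> s"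

definition refl2 ::
    "('s \<Rightarrow> 'a::real_vector) \<Rightarrow> ('s \<Rightarrow> 'b::real_vector) \<Rightarrow> ('a \<Rightarrow> 'b \<Rightarrow> real) \<Rightarrow> 's \<Rightarrow> 'b \<Rightarrow> 'b" where
  "refl2 \<alpha> \<beta> B s y = y - (2 * B (\<alpha> s) y) *\<^sub>R \<beta> s"

definition Phi1 ::
    "('s \<Rightarrow> 's \<Rightarrow> enat) \<Rightarrow> ('s \<Rightarrow> 'a::real_vector) \<Rightarrow> ('s \<Rightarrow> 'b::real_vector) \<Rightarrow>
     ('a \<Rightarrow> 'b \<Rightarrow> real) \<Rightarrow> 'a set" where
  "Phi1 m \<alpha> \<beta> B = orbit_of_simple m (refl1 \<alpha> \<beta> B) \<alpha>"

definition Phi2 ::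
    "('s \<Rightarrow> 's \<Rightarrow> enat) \<Rightarrow> ('s \<Rightarrow> 'a::real_vector) \<Rightarrow> ('s \<Rightarrow> 'b::real_vector) \<Rightarrow>
     ('a \<Rightarrow> 'b \<Rightarrow> real) \<Rightarrow> 'b set" where
  "Phi2 m \<alpha> \<beta> B = orbit_of_simple m (refl2 \<alpha> \<beta> B) \<beta>"

text \<open>Membership in \<open>extensional\<close> only pins down the irrelevant values off \<open>\<Phi>\<^sub>1\<close>.\<close>

definition phi ::
    "('s \<Rightarrow> 's \<Rightarrow> enat) \<Rightarrow> ('s \<Rightarrow> 'a::real_vector) \<Rightarrow> ('s \<Rightarrow> 'b::real_vector) \<Rightarrow>
     ('a \<Rightarrow> 'b \<Rightarrow> real) \<Rightarrow> 'a \<Rightarrow> 'b" where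
  "phi m \<alpha> \<beta> B = (THE f.
     f \<in> extensional (Phi1 m \<alpha> \<beta> B) \<and>
     bij_betw f (Phi1 m \<alpha> \<beta> B) (Phi2 m \<alpha> \<beta> B) \<and>
     (\<forall>w\<in>carrier (coxeter_group m). \<forall>x\<in>Phi1 m \<alpha> \<beta> B.
        f (coxeter_act (refl1 \<alpha> \<beta> B) w x) = coxeter_act (refl2 \<alpha> \<beta> B) w (f x)) \<and>
     (\<forall>s. f (\<alpha> s) = \<beta> s))"

section \<open>Canonical coefficients\<close>

definition indexed_basis :: "('s \<Rightarrow> 'v::real_vector) \<Rightarrow> bool" where
  "indexed_basis e \<longleftrightarrow> inj e \<and> independent (range e) \<and> span (range e) = UNIV"

definition basis_coeff :: "('s \<Rightarrow> 'v::real_vector) \<Rightarrow> 's \<Rightarrow> 'v \<Rightarrow> real" where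
  "basis_coeff e s x = representation (range e) x (e s)"

text \<open>The datum \<open>\<C>'\<close> on spaces with bases \<open>\<alpha>'\<close>, \<open>\<beta>'\<close> and the same pairing of simple roots.\<close>

locale free_datum =
  fixes \<alpha> :: "'s \<Rightarrow> 'a::real_vector"
    and \<beta> :: "'s \<Rightarrow> 'b::real_vector"
    and B :: "'a \<Rightarrow> 'b \<Rightarrow> real"
    and \<alpha>' :: "'s \<Rightarrow> 'c::real_vector"
    and \<beta>' :: "'s \<Rightarrow> 'd::real_vector"
    and B' :: "'c \<Rightarrow> 'd \<Rightarrow> real"
  assumes basis1: "indexed_basis \<alpha>'"
    and basis2: "indexed_basis \<beta>'"
    and bilinear': "bilinear B'"
    and pairing: "\<And>s t. B' (\<alpha>' s) (\<beta>' t) = B (\<alpha> s) (\<beta> t)"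

definition linear_map_of :: "('s \<Rightarrow> 'v::real_vector) \<Rightarrow> ('s \<Rightarrow> 'w::real_vector) \<Rightarrow> 'v \<Rightarrow> 'w" where
  "linear_map_of e g = (THE f. linear f \<and> (\<forall>s. f (e s) = g s))"

definition coeff1 ::
    "('s \<Rightarrow> 's \<Rightarrow> enat) \<Rightarrow> ('s \<Rightarrow> 'a::real_vector) \<Rightarrow> ('s \<Rightarrow> 'c::real_vector) \<Rightarrow>
     ('s \<Rightarrow> 'd::real_vector) \<Rightarrow> ('c \<Rightarrow> 'd \<Rightarrow> real) \<Rightarrow> 's \<Rightarrow> 'a \<Rightarrow> real" where
  "coeff1 m \<alpha> \<alpha>' \<beta>' B' s z =
     basis_coeff \<alpha>' s (THE z'. z' \<in> Phi1 m \<alpha>' \<beta>' B' \<and> linear_map_of \<alpha>' \<alpha> z' = z)"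

definition coeff2 ::
    "('s \<Rightarrow> 's \<Rightarrow> enat) \<Rightarrow> ('s \<Rightarrow> 'b::real_vector) \<Rightarrow> ('s \<Rightarrow> 'c::real_vector) \<Rightarrow>
     ('s \<Rightarrow> 'd::real_vector) \<Rightarrow> ('c \<Rightarrow> 'd \<Rightarrow> real) \<Rightarrow> 's \<Rightarrow> 'b \<Rightarrow> real" where
  "coeff2 m \<beta> \<alpha>' \<beta>' B' s z =
     basis_coeff \<beta>' s (THE z'. z' \<in> Phi2 m \<alpha>' \<beta>' B' \<and> linear_map_of \<beta>' \<beta> z' = z)"

section \<open>The standard geometric realization\<close>

locale standard_realization =
  fixes \<alpha> :: "'s \<Rightarrow> 'a::real_vector"
    and \<beta> :: "'s \<Rightarrow> 'b::real_vector"
    and B :: "'a \<Rightarrow> 'b \<Rightarrow> real"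
    and \<gamma> :: "'s \<Rightarrow> 'v::real_vector"
    and G :: "'v \<Rightarrow> 'v \<Rightarrow> real"
  assumes basis: "indexed_basis \<gamma>"
    and bilinear_G: "bilinear G"
    and symmetric: "\<And>x y. G x y = G y x"
    and unit: "\<And>s. G (\<gamma> s) (\<gamma> s) = 1"
    and nonpos: "\<And>s t. s \<noteq> t \<Longrightarrow> G (\<gamma> s) (\<gamma> t) \<le> 0"
    and square: "\<And>s t. (G (\<gamma> s) (\<gamma> t))\<^sup>2 = B (\<alpha> s) (\<beta> t) * B (\<alpha> t) (\<beta> s)"

text \<open>The action \<open>r\<^sub>s v = v - 2 (v, \<gamma>\<^sub>s) \<gamma>\<^sub>s\<close> is \<^term>\<open>refl1 \<gamma> \<gamma> G\<close>, so \<open>\<Phi>\<close> is \<^term>\<open>Phi1 m \<gamma> \<gamma> G\<close>.\<close>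

definition phi_1 ::
    "('s \<Rightarrow> 's \<Rightarrow> enat) \<Rightarrow> ('s \<Rightarrow> 'a::real_vector) \<Rightarrow> ('s \<Rightarrow> 'b::real_vector) \<Rightarrow>
     ('a \<Rightarrow> 'b \<Rightarrow> real) \<Rightarrow> ('s \<Rightarrow> 'v::real_vector) \<Rightarrow> ('v \<Rightarrow> 'v \<Rightarrow> real) \<Rightarrow> 'a \<Rightarrow> 'v" where
  "phi_1 m \<alpha> \<beta> B \<gamma> G = (THE f.
     f \<in> Phi1 m \<alpha> \<beta> B \<rightarrow>\<^sub>E Phi1 m \<gamma> \<gamma> G \<and>
     (\<forall>w\<in>carrier (coxeter_group m). \<forall>x\<in>Phi1 m \<alpha> \<beta> B.
        f (coxeter_act (refl1 \<alpha> \<beta> B) w x) = coxeter_act (refl1 \<gamma> \<gamma> G) w (f x)) \<and>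
     (\<forall>s. f (\<alpha> s) = \<gamma> s))"

end

theory Submission
  imports Defs
begin

text \<open>
  The inequality is a Cauchy-Schwarz inequality, carried through the classical proof that every
  root is positive or negative.

  Write a root of the free datum as \<open>w \<alpha>'\<^sub>s\<close>, and compare it with \<open>w \<beta>'\<^sub>s\<close> and \<open>w \<gamma>\<^sub>s\<close>. If \<open>w \<noteq> 1\<close>
  and the word \<open>w s\<close> is reduced, then \<open>w = v d\<close> with \<open>d\<close> in a dihedral subgroup \<open>\<langle>s, t\<rangle>\<close>, with \<open>v\<close>
  shorter than \<open>w\<close> and both \<open>v s\<close> and \<open>v t\<close> reduced. In rank two the three actions differ only by a rescaling of
  one simple root: \<open>d \<gamma>\<^sub>s = p \<gamma>\<^sub>s + q \<gamma>\<^sub>t\<close> with \<open>p, q \<ge> 0\<close> implies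
  \<open>d \<alpha>'\<^sub>s = p \<alpha>'\<^sub>s + q \<kappa> \<alpha>'\<^sub>t\<close> and \<open>d \<beta>'\<^sub>s = p \<beta>'\<^sub>s + (q / \<kappa>) \<beta>'\<^sub>t\<close>. Applying \<open>v\<close>, the coefficient
  triples for \<open>w s\<close> are combinations of those for \<open>v s\<close> and \<open>v t\<close>. The relation
  \<open>x, y, z \<ge> 0\<close>, \<open>z\<^sup>2 \<le> x y\<close>, \<open>x = 0 \<longleftrightarrow> y = 0\<close> (\<open>dominates\<close>) is preserved by such combinations, and so
  holds by induction on the length (\<open>reduced_dominates\<close>). A root \<open>w \<alpha>'\<^sub>s\<close> with \<open>w\<close> but not \<open>w s\<close> reduced
  is the negative of one of these, which leaves the products unchanged.

  To speak of \<open>\<phi>\<close>, \<open>\<phi>\<^sub>1\<close> and the canonical coefficients at all, one must know that \<open>w \<alpha>\<^sub>s = \<alpha>\<^sub>t\<close>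
  forces the same equation in every other realization. In the free datum it follows from the
  expansion of \<open>w \<alpha>'\<^sub>s\<close> with coefficients of one sign and the positivity conditions on a Coxeter
  datum (\<open>free_fixed_of_fixed\<close>). From there it passes to the dual and the standard side, because
  equal supports make \<open>w \<beta>'\<^sub>s\<close> a multiple of \<open>\<beta>'\<^sub>t\<close>, the inequality makes \<open>w \<gamma>\<^sub>s\<close> a multiple of
  \<open>\<gamma>\<^sub>t\<close>, and invariance of the pairings determines the factor (\<open>free_fixed_transfer\<close>).
\<close>

section \<open>Reduced words\<close>

definition reduced :: "('s \<Rightarrow> 's \<Rightarrow> enat) \<Rightarrow> 's list \<Rightarrow> bool" where
  "reduced m w \<longleftrightarrow> (\<forall>v. coxeter_eq m w v \<longrightarrow> length w \<le> length v)"

lemma coxeter_eq_even_length: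
  "coxeter_eq m u v \<Longrightarrow> even (length u) \<longleftrightarrow> even (length v)"
proof (induction rule: coxeter_eq.induct)
  case (order s t k u v)
  have "length (concat (replicate k [s, t])) = 2 * k" by (induction k) auto
  then show ?case by simp
qed auto

lemma coxeter_eq_cancel_square: "coxeter_eq m (u @ [s, s]) u"
  using coxeter_eq.square[of m u s "[]"] by simp

lemma ex_reduced: "\<exists>v. coxeter_eq m w v \<and> reduced m v"
proof -
  obtain v where "coxeter_eq m w v" "\<And>v'. coxeter_eq m w v' \<Longrightarrow> length v \<le> length v'"
    using ex_has_least_nat[of "coxeter_eq m w" w length] coxeter_eq.refl by blast
  then show ?thesis unfolding reduced_def using coxeter_eq.trans[of m w v] by meson
qed

lemma reduced_of_shorter:
  assumes "reduced m w" "coxeter_eq m w v" "length v \<le> length w"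
  shows "reduced m v"
  using assms unfolding reduced_def by (meson coxeter_eq.trans le_trans)

lemma reduced_suffix:
  assumes "reduced m (u @ v)" shows "reduced m v"
  unfolding reduced_def
proof (intro allI impI)
  fix v' assume "coxeter_eq m v v'"
  then have "coxeter_eq m (u @ v) (u @ v')" by (intro coxeter_eq_append coxeter_eq.refl)
  with assms have "length (u @ v) \<le> length (u @ v')" unfolding reduced_def by blast
  then show "length v \<le> length v'" by simp
qed

lemma reduced_prefix:
  assumes "reduced m (u @ v)" shows "reduced m u"
  unfolding reduced_def
proof (intro allI impI)
  fix u' assume "coxeter_eq m u u'"
  then have "coxeter_eq m (u @ v) (u' @ v)" by (intro coxeter_eq_append coxeter_eq.refl)
  with assms have "length (u @ v) \<le> length (u' @ v)" unfolding reduced_def by blast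
  then show "length u \<le> length u'" by simp
qed

lemma not_reduced_square: "\<not> reduced m (s # s # w)"
  using coxeter_eq.square[of m "[]" s w] unfolding reduced_def by (auto dest: spec[of _ w])

text \<open>
  All relations have even length, so multiplying by a generator changes the minimal length
  by exactly one.
\<close>

lemma descent:
  assumes "reduced m v" "\<not> reduced m (v @ [s])"
  obtains v' where "coxeter_eq m v (v' @ [s])" "length v' < length v" "reduced m (v' @ [s])"
proof -
  from assms(2) obtain v' where v': "coxeter_eq m (v @ [s]) v'" "length v' < length v + 1"
    unfolding reduced_def by auto
  have "even (length v') \<longleftrightarrow> even (length v + 1)"
    using coxeter_eq_even_length[OF v'(1)] by simp
  then have "length v' \<noteq> length v" by auto
  with v'(2) have len: "length v' < length v" by simp
  have "coxeter_eq m (v @ [s, s]) (v' @ [s])"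
    using coxeter_eq_append[OF v'(1) coxeter_eq.refl[of m "[s]"]] by simp
  with coxeter_eq.sym[OF coxeter_eq_cancel_square] have eq: "coxeter_eq m v (v' @ [s])"
    by (rule coxeter_eq.trans)
  show thesis
    using len by (intro that[OF eq len] reduced_of_shorter[OF assms(1) eq]) simp
qed

text \<open>
  The letters are prepended, so that every nonempty word ends in \<open>t\<close>: these are the words that stay
  alternating when \<open>s\<close> is appended, and the action on \<open>\<alpha>\<^sub>s\<close> can be computed one letter at a time.
\<close>

primrec alternating :: "'s \<Rightarrow> 's \<Rightarrow> nat \<Rightarrow> 's list" where
  "alternating s t 0 = []"
| "alternating s t (Suc n) = (if even n then t else s) # alternating s t n"

lemma length_alternating [simp]: "length (alternating s t n) = n"
  by (induction n) auto

lemma set_alternating: "set (alternating s t n) \<subseteq> {s, t}"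
  by (induction n) auto

lemma alternating_double: "alternating s t (2 * k) = concat (replicate k [s, t])"
  by (induction k) auto

lemma alternating_add: "\<exists>u. alternating s t (j + n) = u @ alternating s t n \<and> length u = j"
  by (induction j) (auto intro: exI[of _ "_ # _"])

lemma reduced_dihedral_alternating:
  assumes "set d \<subseteq> {s, t}" "reduced m (d @ [s])"
  shows "d = alternating s t (length d)"
  using assms
proof (induction d)
  case (Cons x d)
  have "reduced m (d @ [s])" using reduced_suffix[of m "[x]" "d @ [s]"] Cons.prems by simp
  then have d: "d = alternating s t (length d)" using Cons by auto
  have "x = (if even (length d) then t else s)"
  proof (cases "length d")
    case 0
    then have "d = []" by simp
    then have "x \<noteq> s" using Cons.prems(2) not_reduced_square[of m s "[]"] by auto
    then show ?thesis using Cons.prems(1) 0 by auto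
  next
    case (Suc n)
    then have "d = (if even n then t else s) # alternating s t n" using d by simp
    then have "x \<noteq> (if even n then t else s)"
      using Cons.prems(2) not_reduced_square[of m x "alternating s t n @ [s]"] by auto
    then show ?thesis using Cons.prems(1) Suc by (auto split: if_splits)
  qed
  then show ?case using d by simp
qed simp

text \<open>
  The relation \<open>(st)\<^sup>k = 1\<close> equates the alternating word of length \<open>k + 1\<close> with one of
  length \<open>k - 1\<close>.
\<close>

lemma reduced_alternating_bound:
  assumes "reduced m (alternating s t n @ [s])" "m s t = enat k" "0 < k"
  shows "n < k"
proof (rule ccontr)
  assume "\<not> n < k"
  then obtain u where u: "alternating s t n = u @ alternating s t k"
    using alternating_add[of s t "n - k" k] by auto
  let ?d = "alternating s t k"
  have red: "reduced m (?d @ [s])" using assms(1) reduced_suffix[of m u] by (simp add: u)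
  \<comment> \<open>\<open>R\<close> is the complementary half of \<open>(st)\<^sup>k\<close>, so \<open>rev R\<close> is equivalent to \<open>?d\<close>, and it ends
    in \<open>s\<close>.\<close>
  obtain R where R: "alternating s t (2 * k) = R @ ?d" "length R = k"
    using alternating_add[of s t k k] by (auto simp: mult_2)
  obtain k' where k': "k = Suc k'" using assms(3) gr0_implies_Suc by blast
  obtain R' where R': "R = s # R'" using R by (cases R) (auto simp: k')
  have "coxeter_eq m (R @ ?d) []"
    using coxeter_eq.order[of m s t k "[]" "[]"] assms(2) R(1) alternating_double[of s t k] by simp
  then have "coxeter_eq m (rev R @ R @ ?d) (rev R)"
    using coxeter_eq_append[OF coxeter_eq.refl[of m "rev R"]] by fastforce
  moreover have "coxeter_eq m (rev R @ R @ ?d) ?d"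
    using coxeter_eq_append[OF coxeter_eq_rev[of m R] coxeter_eq.refl[of m ?d]] by simp
  ultimately have "coxeter_eq m ?d (rev R)" using coxeter_eq.trans coxeter_eq.sym by metis
  then have "coxeter_eq m (?d @ [s]) (rev R @ [s])"
    by (intro coxeter_eq_append coxeter_eq.refl)
  moreover have "coxeter_eq m (rev R @ [s]) (rev R')"
    using coxeter_eq_cancel_square[of m "rev R'" s] by (simp add: R')
  ultimately have "coxeter_eq m (?d @ [s]) (rev R')" by (rule coxeter_eq.trans)
  then show False using red R(2) unfolding reduced_def by (auto simp: R')
qed

text \<open>
  Here \<open>t\<close> is the last letter of \<open>w\<close>, and \<open>v\<close> is shortest among all decompositions \<open>w = v d\<close> with
  \<open>d\<close> in the subgroup generated by \<open>s\<close> and \<open>t\<close> in which the lengths add up. If \<open>v\<close> had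
  a descent at \<open>s\<close> or \<open>t\<close>, that letter could be moved from \<open>v\<close> to \<open>d\<close>.
\<close>

lemma parabolic_decomposition:
  assumes red: "reduced m (w @ [s])" and ne: "w \<noteq> []"
  obtains t v d where "t \<noteq> s" "coxeter_eq m w (v @ d)" "length v < length w"
    "reduced m (v @ [s])" "reduced m (v @ [t])" "set d \<subseteq> {s, t}" "reduced m (d @ [s])"
proof -
  define t where "t = last w"
  have w: "w = butlast w @ [t]" using ne by (simp add: t_def)
  have rw: "reduced m w" using red by (rule reduced_prefix)
  have ts: "t \<noteq> s"
    using red reduced_suffix[of m "butlast w" "[t, s]"] w not_reduced_square[of m s "[]"]
    by (metis append.assoc append_Cons append_Nil)
  define D where "D v \<longleftrightarrow> (\<exists>d. coxeter_eq m w (v @ d) \<and> set d \<subseteq> {s, t} \<and>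
    length v + length d \<le> length w)" for v
  have D0: "D (butlast w)"
    unfolding D_def using w ne by (intro exI[of _ "[t]"]) (auto intro: coxeter_eq.refl)
  obtain v where v: "D v" and vmin: "\<And>v'. D v' \<Longrightarrow> length v \<le> length v'"
    using ex_has_least_nat[of D "butlast w" length] D0 by blast
  obtain d where d: "coxeter_eq m w (v @ d)" "set d \<subseteq> {s, t}" "length v + length d \<le> length w"
    using v D_def by blast
  have rvd: "reduced m (v @ d)" using reduced_of_shorter[OF rw d(1)] d(3) by simp
  have rv: "reduced m v" using reduced_prefix[OF rvd] .
  have up: "reduced m (v @ [x])" if x: "x \<in> {s, t}" for x
  proof (rule ccontr)
    assume "\<not> reduced m (v @ [x])"
    then obtain v' where v': "coxeter_eq m v (v' @ [x])" "length v' < length v"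
      using descent[OF rv] by metis
    have "coxeter_eq m w (v' @ x # d)"
      using coxeter_eq.trans[OF d(1) coxeter_eq_append[OF v'(1) coxeter_eq.refl]] by simp
    then have "D v'" unfolding D_def using x d v' by (intro exI[of _ "x # d"]) auto
    then show False using vmin v'(2) by fastforce
  qed
  have "reduced m ((v @ d) @ [s])"
    using d(3) by (intro reduced_of_shorter[OF red coxeter_eq_append[OF d(1) coxeter_eq.refl]]) simp
  then have rds: "reduced m (d @ [s])" using reduced_suffix[of m v "d @ [s]"] by simp
  have "length v \<le> length w - 1" "0 < length w" using vmin[OF D0] ne by simp_all
  then have lt: "length v < length w" by linarith
  have "reduced m (v @ [s])" "reduced m (v @ [t])" using up by simp_all
  from that[OF ts d(1) lt this d(2) rds] show thesis .
qed

section \<open>Dihedral subgroups\<close>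

text \<open>
  The Chebyshev polynomials of the second kind with their index shifted by one, so that
  \<open>sin x * cheb (cos x) n = sin (n x)\<close>. They are the coefficients of the roots of a dihedral group.
\<close>

fun cheb :: "real \<Rightarrow> nat \<Rightarrow> real" where
  "cheb c 0 = 0"
| "cheb c (Suc 0) = 1"
| "cheb c (Suc (Suc n)) = 2 * c * cheb c (Suc n) - cheb c n"

lemma cheb_cos: "sin x * cheb (cos x) n = sin (real n * x)"
proof (induction "cos x" n rule: cheb.induct)
  case (3 n)
  have "sin x * cheb (cos x) (Suc (Suc n))
    = 2 * cos x * (sin x * cheb (cos x) (Suc n)) - sin x * cheb (cos x) n"
    by (simp add: algebra_simps)
  also have "\<dots> = 2 * cos x * sin (real n * x + x) - sin (real n * x)"
    unfolding 3 by (simp add: algebra_simps)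
  also have "\<dots> = sin (real n * x + x + x)"
    unfolding sin_add cos_add using sin_cos_squared_add[of x]
    by algebra
  finally show ?case by (simp add: algebra_simps)
qed auto

lemma cheb_nonneg_hyperbolic:
  assumes "1 \<le> c" shows "0 \<le> cheb c n"
proof -
  have "0 \<le> cheb c n \<and> cheb c n \<le> cheb c (Suc n)"
  proof (induction n)
    case (Suc n)
    have "1 * cheb c (Suc n) \<le> c * cheb c (Suc n)"
      using Suc assms by (intro mult_right_mono) auto
    then show ?case using Suc by simp
  qed simp
  then show ?thesis by simp
qed

lemma angle_facts:
  assumes "2 \<le> (k::nat)"
  shows "0 \<le> cos (pi / k)" "0 < sin (pi / k)"
proof -
  have "pi / k \<le> pi / 2" using assms by (intro divide_left_mono) auto
  moreover have "0 < pi / k" using assms by simp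
  moreover from calculation have "pi / k < pi" using pi_gt_zero by linarith
  ultimately show "0 \<le> cos (pi / k)" "0 < sin (pi / k)"
    by (auto intro!: cos_ge_zero sin_gt_zero)
qed

text \<open>
  All multiples \<open>n \<pi> / k\<close> with \<open>n \<le> k\<close> lie in the half circle where the sine is non-negative. For
  the coefficients of a root, \<open>n \<le> k\<close> is the bound on the length of a reduced alternating word.
\<close>

lemma cheb_nonneg_elliptic:
  assumes "2 \<le> (k::nat)" "n \<le> k" shows "0 \<le> cheb (cos (pi / k)) n"
proof -
  have "real n * (pi / k) \<le> pi" using assms by (simp add: field_simps)
  then have "0 \<le> sin (real n * (pi / k))" using assms by (intro sin_ge_zero) auto
  then have "0 \<le> sin (pi / k) * cheb (cos (pi / k)) n" by (simp only: cheb_cos)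
  then show ?thesis using angle_facts(2)[OF assms(1)] by (simp only: zero_le_mult_iff) auto
qed

lemma cheb_period:
  assumes "2 \<le> (k::nat)"
  shows "cheb (cos (pi / k)) (2 * k) = 0" "cheb (cos (pi / k)) (Suc (2 * k)) = 1"
proof -
  have e: "real (2 * k) * (pi / k) = 2 * pi" "real (Suc (2 * k)) * (pi / k) = pi / k + 2 * pi"
    using assms by (auto simp: field_simps)
  have "sin (pi / k) * cheb (cos (pi / k)) (2 * k) = 0" unfolding cheb_cos e by simp
  moreover have "sin (pi / k) * cheb (cos (pi / k)) (Suc (2 * k)) = sin (pi / k)"
    unfolding cheb_cos e by (simp add: sin_add)
  ultimately show "cheb (cos (pi / k)) (2 * k) = 0" "cheb (cos (pi / k)) (Suc (2 * k)) = 1"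
    using angle_facts[OF assms] by auto
qed

text \<open>
  The hypotheses are those of a symmetric pair of reflections with form value \<open>- c\<close> between \<open>x\<close> and
  \<open>y\<close>; the vector \<open>y\<close> is left free so that it may be a rescaled simple root.
\<close>

lemma alternating_action:
  fixes f :: "'s \<Rightarrow> 'v::real_vector \<Rightarrow> 'v"
  assumes lin: "\<And>i. linear (f i)"
    and "f s x = - x" "f s y = y + (2 * c) *\<^sub>R x" "f t y = - y" "f t x = x + (2 * c) *\<^sub>R y"
  shows "foldr f (alternating s t n) x =
    (if even n then cheb c (Suc n) *\<^sub>R x + cheb c n *\<^sub>R y
     else cheb c n *\<^sub>R x + cheb c (Suc n) *\<^sub>R y)"
proof (induction n)
  case (Suc n)
  show ?case
    using assms(2-) by (cases "even n")
      (simp_all add: Suc linear_add[OF lin] linear_scale[OF lin] algebra_simps)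
qed simp

section \<open>The action on a Coxeter datum\<close>

lemma refl2_eq_refl1: "refl2 \<alpha> \<beta> B = refl1 \<beta> \<alpha> (\<lambda>y x. B x y)"
  by (intro ext) (simp add: refl1_def refl2_def)

lemma linear_refl1:
  assumes "bilinear B" shows "linear (refl1 \<alpha> \<beta> B s)"
  unfolding refl1_def
  by (rule linearI)
    (simp_all add: bilinear_ladd[OF assms] bilinear_lmul[OF assms] algebra_simps)

lemma linear_foldr: "(\<And>s. linear (f s)) \<Longrightarrow> linear (foldr f u)"
proof (induction u)
  case (Cons a u)
  then show ?case using linear_compose[of "foldr f u" "f a"] by (simp add: comp_def)
qed (simp add: linear_id[unfolded id_def] id_def)

context coxeter_datum
begin

abbreviation act :: "'s list \<Rightarrow> 'a \<Rightarrow> 'a" where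
  "act \<equiv> foldr (refl1 \<alpha> \<beta> B)"

lemma swapped_datum: "coxeter_datum m \<beta> \<alpha> (\<lambda>y x. B x y)"
proof
  show "bilinear (\<lambda>y x. B x y)" using bilinear by (simp add: bilinear_def)
  show "B (\<alpha> t) (\<beta> s) * B (\<alpha> s) (\<beta> t) = (cos (pi / real k))\<^sup>2" if "m s t = enat k" for s t k
    using C3_finite[OF that] by (simp add: mult.commute)
  show "\<exists>c\<ge>1. B (\<alpha> t) (\<beta> s) * B (\<alpha> s) (\<beta> t) = c\<^sup>2" if "m s t = \<infinity>" for s t
    using C3_infinite[OF that] by (simp add: mult.commute)
qed (use matrix C1 C2 C4 C5_1 C5_2 in auto)

lemma linear_act: "linear (act u)"
  by (intro linear_foldr linear_refl1 bilinear)

lemma refl1_simple: "refl1 \<alpha> \<beta> B s (\<alpha> s) = - \<alpha> s"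
  by (simp add: refl1_def C1 scaleR_2)

lemma refl1_involution: "refl1 \<alpha> \<beta> B s (refl1 \<alpha> \<beta> B s x) = x"
  by (simp add: refl1_def bilinear_lsub[OF bilinear] bilinear_lmul[OF bilinear] C1
      scaleR_left_diff_distrib)

lemma act_rev: "act (rev u) (act u x) = x"
  by (induction u arbitrary: x) (auto simp: refl1_involution)

lemma order_ge_2: "s \<noteq> t \<Longrightarrow> m s t = enat k \<Longrightarrow> 2 \<le> k"
  using matrix unfolding coxeter_matrix_def by (metis enat_ord_simps(1) numeral_eq_enat)

text \<open>
  For \<open>s \<noteq> t\<close> this is \<open>- (\<gamma>\<^sub>s, \<gamma>\<^sub>t)\<close> in the standard realization. It depends only on the products of
  opposite pairings, so it is the same number for all realizations that are compared.
\<close>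

definition edge :: "'s \<Rightarrow> 's \<Rightarrow> real" where
  "edge s t = sqrt (B (\<alpha> s) (\<beta> t) * B (\<alpha> t) (\<beta> s))"

lemma edge_sq: "(edge s t)\<^sup>2 = B (\<alpha> s) (\<beta> t) * B (\<alpha> t) (\<beta> s)"
proof -
  have "0 \<le> B (\<alpha> s) (\<beta> t) * B (\<alpha> t) (\<beta> s)"
    using C2[of s t] C2[of t s] C1 by (cases "s = t") (auto intro: mult_nonpos_nonpos)
  then show ?thesis by (simp add: edge_def)
qed

lemma edge_finite: "s \<noteq> t \<Longrightarrow> m s t = enat k \<Longrightarrow> edge s t = cos (pi / k)"
  using angle_facts[OF order_ge_2] by (simp add: edge_def C3_finite)

lemma edge_infinite: "m s t = \<infinity> \<Longrightarrow> 1 \<le> edge s t"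
  using C3_infinite[of s t] by (auto simp: edge_def)

lemma edge_scaling:
  assumes "s \<noteq> t"
  obtains \<kappa> where "0 < \<kappa>" "B (\<alpha> s) (\<beta> t) = - edge s t * \<kappa>" "B (\<alpha> t) (\<beta> s) = - edge s t / \<kappa>"
proof (cases "B (\<alpha> s) (\<beta> t) = 0")
  case True
  then show ?thesis using C4[of s t] that[of 1] by (simp add: edge_def)
next
  case False
  then have neg: "B (\<alpha> s) (\<beta> t) < 0" "B (\<alpha> t) (\<beta> s) < 0"
    using C2[OF assms] C2[of t s] C4[of s t] assms by force+
  then have e: "0 < edge s t" by (simp add: edge_def mult_neg_neg)
  show ?thesis
  proof (rule that[of "- B (\<alpha> s) (\<beta> t) / edge s t"])
    show "B (\<alpha> t) (\<beta> s) = - edge s t / (- B (\<alpha> s) (\<beta> t) / edge s t)"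
      using e neg edge_sq[of s t] by (simp add: field_simps power2_eq_square)
  qed (use e neg in \<open>auto simp: divide_neg_pos\<close>)
qed

text \<open>
  After rescaling \<open>\<alpha>\<^sub>t\<close> the two reflections act on the span of \<open>\<alpha>\<^sub>s\<close> and \<open>\<alpha>\<^sub>t\<close> as in the
  symmetric case; only the scaling factor remembers the asymmetry of the pairing.
\<close>

lemma act_alternating:
  assumes "0 < \<kappa>" "B (\<alpha> s) (\<beta> t) = - edge s t * \<kappa>" "B (\<alpha> t) (\<beta> s) = - edge s t / \<kappa>"
  shows "act (alternating s t n) (\<alpha> s) =
    (if even n then cheb (edge s t) (Suc n) *\<^sub>R \<alpha> s + (cheb (edge s t) n * \<kappa>) *\<^sub>R \<alpha> t
     else cheb (edge s t) n *\<^sub>R \<alpha> s + (cheb (edge s t) (Suc n) * \<kappa>) *\<^sub>R \<alpha> t)"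
proof -
  have t: "refl1 \<alpha> \<beta> B t (\<kappa> *\<^sub>R \<alpha> t) = - (\<kappa> *\<^sub>R \<alpha> t)"
    by (simp add: linear_scale[OF linear_refl1[OF bilinear]] refl1_simple)
  have "refl1 \<alpha> \<beta> B s (\<kappa> *\<^sub>R \<alpha> t) = \<kappa> *\<^sub>R \<alpha> t + (2 * edge s t) *\<^sub>R \<alpha> s"
    "refl1 \<alpha> \<beta> B t (\<alpha> s) = \<alpha> s + (2 * edge s t) *\<^sub>R \<kappa> *\<^sub>R \<alpha> t"
    using assms by (simp_all add: refl1_def bilinear_lmul[OF bilinear])
  from alternating_action[where f = "refl1 \<alpha> \<beta> B",
      OF linear_refl1[OF bilinear] refl1_simple this(1) t this(2)]
  show ?thesis by simp
qed

lemma cheb_edge_nonneg: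
  assumes "s \<noteq> t" "reduced m (alternating s t n @ [s])" "i \<le> Suc n"
  shows "0 \<le> cheb (edge s t) i"
proof (cases "m s t")
  case (enat k)
  then have "2 \<le> k" by (rule order_ge_2[OF assms(1)])
  moreover from this have "n < k" using reduced_alternating_bound[OF assms(2) enat] by simp
  ultimately show ?thesis
    using assms(3) unfolding edge_finite[OF assms(1) enat] by (intro cheb_nonneg_elliptic) auto
next
  case infinity
  then show ?thesis by (intro cheb_nonneg_hyperbolic edge_infinite)
qed

lemma act_fixed:
  assumes "B x (\<beta> s) = 0" "B x (\<beta> t) = 0" "set u \<subseteq> {s, t}"
  shows "act u x = x"
  using assms(3) by (induction u) (auto simp: refl1_def assms)

text \<open>
  The alternating word of length \<open>2 k\<close> is a full turn in the plane of the two simple roots, and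
  it acts trivially on the complement of the plane that both reflections fix.
\<close>

lemma act_order:
  assumes st: "m s t = enat k"
  shows "act (concat (replicate k [s, t])) x = x"
proof (cases "s = t")
  case True
  show ?thesis unfolding True by (induction k) (auto simp: refl1_involution)
next
  case False
  have k: "2 \<le> k" by (rule order_ge_2[OF False st])
  have ts: "m t s = enat k" using st matrix unfolding coxeter_matrix_def by metis
  have fix_first: "act (alternating a b (2 * k)) (\<alpha> a) = \<alpha> a" if ab: "a \<noteq> b" "m a b = enat k" for a b
  proof -
    obtain \<kappa> where "0 < \<kappa>" "B (\<alpha> a) (\<beta> b) = - edge a b * \<kappa>" "B (\<alpha> b) (\<beta> a) = - edge a b / \<kappa>"
      using edge_scaling[OF ab(1)] .
    from act_alternating[OF this, of "2 * k"] show ?thesis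
      by (simp add: edge_finite[OF ab] cheb_period[OF k])
  qed
  let ?w = "alternating s t (2 * k)"
  have rev: "rev (alternating t s (2 * k)) = ?w"
  proof -
    have "rev (concat (replicate k [t, s])) = concat (replicate k [s, t])"
      by (simp add: rev_concat map_replicate)
    then show ?thesis by (simp only: alternating_double)
  qed
  have s: "act ?w (\<alpha> s) = \<alpha> s" by (rule fix_first[OF False st])
  have t: "act ?w (\<alpha> t) = \<alpha> t"
    using act_rev[of "alternating t s (2 * k)" "\<alpha> t"] fix_first[of t s] ts False by (simp add: rev)
  define p where "p = B x (\<beta> s)"
  define q where "q = B x (\<beta> t)"
  define a where "a = B (\<alpha> s) (\<beta> t)"
  define b where "b = B (\<alpha> t) (\<beta> s)"
  define \<Delta> where "\<Delta> = 1 - a * b"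
  have "\<Delta> = (sin (pi / k))\<^sup>2"
    unfolding \<Delta>_def a_def b_def C3_finite[OF st] by (simp add: sin_squared_eq)
  then have nz: "\<Delta> \<noteq> 0" using angle_facts[OF k] by simp
  \<comment> \<open>The Gram matrix of the pair is invertible, so the pair spans a complement of the common
    kernel of \<open>\<beta>\<^sub>s\<close> and \<open>\<beta>\<^sub>t\<close>.\<close>
  define y where "y = ((p - b * q) / \<Delta>) *\<^sub>R \<alpha> s + ((q - a * p) / \<Delta>) *\<^sub>R \<alpha> t"
  have "B y (\<beta> s) = (p - b * q) / \<Delta> + (q - a * p) / \<Delta> * b"
    unfolding y_def b_def
    by (simp add: bilinear_ladd[OF bilinear] bilinear_lmul[OF bilinear] C1)
  also have "\<dots> = (p * \<Delta>) / \<Delta>" unfolding \<Delta>_def add_divide_distrib[symmetric] times_divide_eq_left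
    by (simp add: algebra_simps)
  finally have 1: "B y (\<beta> s) = p" using nz by simp
  have "B y (\<beta> t) = (p - b * q) / \<Delta> * a + (q - a * p) / \<Delta>"
    unfolding y_def a_def
    by (simp add: bilinear_ladd[OF bilinear] bilinear_lmul[OF bilinear] C1)
  also have "\<dots> = (q * \<Delta>) / \<Delta>" unfolding \<Delta>_def add_divide_distrib[symmetric] times_divide_eq_left
    by (simp add: algebra_simps)
  finally have 2: "B y (\<beta> t) = q" using nz by simp
  have "act ?w (x - y) = x - y"
    using 1 2 by (intro act_fixed[of _ s t] set_alternating)
      (simp_all add: bilinear_lsub[OF bilinear] p_def q_def)
  moreover have "act ?w y = y"
    unfolding y_def linear_add[OF linear_act] linear_scale[OF linear_act] s t ..
  ultimately show ?thesis
    unfolding alternating_double using linear_diff[OF linear_act] by (simp add: algebra_simps)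
qed

lemma act_cong: "coxeter_eq m u v \<Longrightarrow> act u x = act v x"
proof (induction arbitrary: x rule: coxeter_eq.induct)
  case (order s t k u v)
  then show ?case using act_order[OF order, of "act v x"] by simp
qed (simp_all add: refl1_involution)

text \<open>
  With this, coincidences between roots need only be studied where both roots are simple.
\<close>

lemma act_eq_iff: "act u x = act v y \<longleftrightarrow> act (rev v @ u) x = y"
proof
  assume "act u x = act v y"
  then show "act (rev v @ u) x = y" by (simp add: act_rev)
next
  assume "act (rev v @ u) x = y"
  then have "act v y = act v (act (rev v) (act u x))" by simp
  then show "act u x = act v y" using act_rev[of "rev v"] by simp
qed

lemma coxeter_act_class: "coxeter_act (refl1 \<alpha> \<beta> B) (coxeter_rel m `` {u}) x = act u x"
proof -
  have "act v x = act u x" if "v \<in> coxeter_rel m `` {u}" for v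
    using that act_cong[of u v x] by (simp add: coxeter_rel_def)
  moreover have "u \<in> coxeter_rel m `` {u}"
    by (simp add: coxeter_rel_def coxeter_eq.refl)
  ultimately have "(\<lambda>v. act v x) ` (coxeter_rel m `` {u}) = {act u x}" by blast
  then show ?thesis unfolding coxeter_act_def by simp
qed

lemma Phi1_eq: "Phi1 m \<alpha> \<beta> B = {act u (\<alpha> s) | u s. True}"
proof -
  have "carrier (coxeter_group m) = range (\<lambda>u. coxeter_rel m `` {u})"
    by (auto simp: coxeter_group_def quotient_def)
  then have "x \<in> Phi1 m \<alpha> \<beta> B \<longleftrightarrow>
      (\<exists>w s. x = coxeter_act (refl1 \<alpha> \<beta> B) w (\<alpha> s) \<and> w \<in> range (\<lambda>u. coxeter_rel m `` {u}))" for x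
    unfolding Phi1_def orbit_of_simple_def by simp
  also have "\<dots> x \<longleftrightarrow> (\<exists>u s. x = coxeter_act (refl1 \<alpha> \<beta> B) (coxeter_rel m `` {u}) (\<alpha> s))" for x
    by (simp only: image_iff bex_UNIV) metis
  finally show ?thesis by (simp add: set_eq_iff coxeter_act_class)
qed

lemma B_invariant: "B (act u x) (foldr (refl2 \<alpha> \<beta> B) u y) = B x y"
proof (induction u)
  case (Cons s u)
  have step: "B (refl1 \<alpha> \<beta> B s x) (refl2 \<alpha> \<beta> B s y) = B x y" for x y
    unfolding refl1_def refl2_def bilinear_lsub[OF bilinear] bilinear_lmul[OF bilinear]
      bilinear_rsub[OF bilinear] bilinear_rmul[OF bilinear] C1
    by simp
  show ?case by (simp add: step Cons)
qed simp

end

section \<open>Coordinates with respect to an indexed basis\<close>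

lemma linear_basis_coeff: "indexed_basis e \<Longrightarrow> linear (basis_coeff e i)"
  by (rule linearI)
    (simp_all add: indexed_basis_def basis_coeff_def representation_add representation_scale)

lemma basis_coeff_basis: "indexed_basis e \<Longrightarrow> basis_coeff e i (e j) = (if i = j then 1 else 0)"
  by (auto simp: indexed_basis_def basis_coeff_def representation_basis inj_eq)

lemma basis_expansion:
  assumes e: "indexed_basis e"
  shows "finite {i. basis_coeff e i x \<noteq> 0}"
    and "(\<Sum>i | basis_coeff e i x \<noteq> 0. basis_coeff e i x *\<^sub>R e i) = x"
proof -
  let ?N = "{i. basis_coeff e i x \<noteq> 0}"
  have inj: "inj_on e ?N" using e by (auto simp: indexed_basis_def intro: inj_on_subset)
  have img: "e ` ?N = {b. representation (range e) x b \<noteq> 0}"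
    using representation_ne_zero[of "range e" x] by (auto simp: basis_coeff_def)
  show "finite ?N" using finite_representation[of "range e" x] finite_imageD[OF _ inj] img by simp
  have "(\<Sum>i\<in>?N. basis_coeff e i x *\<^sub>R e i) = (\<Sum>b\<in>e ` ?N. representation (range e) x b *\<^sub>R b)"
    by (subst sum.reindex[OF inj]) (simp add: basis_coeff_def)
  also have "\<dots> = x"
    unfolding img using e by (intro sum_nonzero_representation_eq) (auto simp: indexed_basis_def)
  finally show "(\<Sum>i\<in>?N. basis_coeff e i x *\<^sub>R e i) = x" .
qed

lemma basis_coeff_eqI:
  assumes e: "indexed_basis e" and eq: "\<And>i. basis_coeff e i x = basis_coeff e i y"
  shows "x = y"
  using basis_expansion(2)[OF e, of x] basis_expansion(2)[OF e, of y] unfolding eq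
  by (rule HOL.trans[OF HOL.sym])

lemma basis_line:
  assumes e: "indexed_basis e" and "\<And>i. i \<noteq> t \<Longrightarrow> basis_coeff e i x = 0"
  shows "x = basis_coeff e t x *\<^sub>R e t"
  by (rule basis_coeff_eqI[OF e])
    (use assms in \<open>simp add: linear_scale[OF linear_basis_coeff[OF e]] basis_coeff_basis[OF e]\<close>)

lemma linear_map_of_basis:
  fixes e :: "'s \<Rightarrow> 'v::real_vector" and g :: "'s \<Rightarrow> 'w::real_vector"
  assumes e: "indexed_basis e"
  shows "linear (linear_map_of e g)" and "linear_map_of e g (e s) = g s"
proof -
  have ind: "independent (range e)" and span: "span (range e) = UNIV" and inj: "inj e"
    using e by (auto simp: indexed_basis_def)
  obtain f where f: "linear f" "\<forall>x\<in>range e. f x = g (inv_into UNIV e x)"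
    using linear_independent_extend[OF ind, of "\<lambda>x. g (inv_into UNIV e x)"] by blast
  have fe: "f (e s) = g s" for s using f(2) inj by simp
  have "linear_map_of e g = f"
    unfolding linear_map_of_def
  proof (rule the_equality)
    fix h assume h: "linear h \<and> (\<forall>s. h (e s) = g s)"
    show "h = f"
    proof
      fix x
      show "h x = f x"
        by (rule linear_eq_on[of h f x "range e"]) (use h f(1) fe span in auto)
    qed
  qed (use f fe in blast)
  then show "linear (linear_map_of e g)" "linear_map_of e g (e s) = g s" using f(1) fe by auto
qed

section \<open>Comparing coefficient triples\<close>

text \<open>
  The clause on zeros says that the first two entries have the same support. It cannot be
  recovered from the inequality, and it is what forces a dual root to be simple when the root is.
\<close>

definition dominates :: "real \<Rightarrow> real \<Rightarrow> real \<Rightarrow> bool" where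
  "dominates x y z \<longleftrightarrow> 0 \<le> x \<and> 0 \<le> y \<and> 0 \<le> z \<and> z\<^sup>2 \<le> x * y \<and> (x = 0 \<longleftrightarrow> y = 0)"

text \<open>
  Cauchy-Schwarz for the vectors of square roots \<open>(\<surd>x, \<surd>x')\<close> and \<open>(\<surd>y, \<surd>y')\<close>.
\<close>

lemma dominates_add:
  assumes "dominates x y z" "dominates x' y' z'"
  shows "dominates (x + x') (y + y') (z + z')"
proof -
  have nn: "0 \<le> x" "0 \<le> y" "0 \<le> z" "0 \<le> x'" "0 \<le> y'" "0 \<le> z'"
    and le: "z\<^sup>2 \<le> x * y" "z'\<^sup>2 \<le> x' * y'"
    using assms by (auto simp: dominates_def)
  have "(2 * (z * z'))\<^sup>2 = 4 * (z\<^sup>2 * z'\<^sup>2)" by (simp add: power_mult_distrib)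
  also have "\<dots> \<le> 4 * ((x * y) * (x' * y'))"
    using mult_mono[OF le] nn by simp
  also have "\<dots> = (x * y' + x' * y)\<^sup>2 - (x * y' - x' * y)\<^sup>2"
    by (simp add: power2_eq_square algebra_simps)
  also have "\<dots> \<le> (x * y' + x' * y)\<^sup>2" by simp
  finally have "2 * (z * z') \<le> x * y' + x' * y"
    by (rule power2_le_imp_le) (use nn in simp)
  then have "(z + z')\<^sup>2 \<le> (x + x') * (y + y')"
    using le by (simp add: power2_sum algebra_simps)
  moreover have "x + x' = 0 \<longleftrightarrow> y + y' = 0"
    using nn assms by (simp add: dominates_def add_nonneg_eq_0_iff)
  ultimately show ?thesis using nn by (simp add: dominates_def)
qed

lemma dominates_scale:
  assumes "dominates x y z" "0 \<le> p" "0 < \<kappa>"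
  shows "dominates (p * \<kappa> * x) (p / \<kappa> * y) (p * z)"
proof -
  have "(p * z)\<^sup>2 \<le> p\<^sup>2 * (x * y)"
    using assms by (auto simp: dominates_def power_mult_distrib intro: mult_left_mono)
  also have "\<dots> = (p * \<kappa> * x) * (p / \<kappa> * y)" using assms by (simp add: power2_eq_square)
  finally show ?thesis using assms by (auto simp: dominates_def)
qed

section \<open>Roots of the free datum and of the standard realization\<close>

text \<open>
  The three realizations side by side. The datum obtained by exchanging the two sides is again of
  this form, so each result about \<open>\<alpha>\<close> also holds for \<open>\<beta>\<close>.
\<close>

locale comparison =
  coxeter_datum m \<alpha> \<beta> B + free_datum \<alpha> \<beta> B \<alpha>' \<beta>' B' + standard_realization \<alpha> \<beta> B \<gamma> G
  for m :: "'s \<Rightarrow> 's \<Rightarrow> enat"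
    and \<alpha> :: "'s \<Rightarrow> 'a::real_vector" and \<beta> :: "'s \<Rightarrow> 'b::real_vector"
    and B :: "'a \<Rightarrow> 'b \<Rightarrow> real"
    and \<alpha>' :: "'s \<Rightarrow> 'c::real_vector" and \<beta>' :: "'s \<Rightarrow> 'd::real_vector"
    and B' :: "'c \<Rightarrow> 'd \<Rightarrow> real"
    and \<gamma> :: "'s \<Rightarrow> 'v::real_vector" and G :: "'v \<Rightarrow> 'v \<Rightarrow> real"

lemma basis_positively_independent:
  assumes e: "indexed_basis e" and "finite F" "(\<Sum>s\<in>F. c s *\<^sub>R e s) = 0"
  shows "\<forall>s\<in>F. c s = 0"
proof
  fix s assume s: "s \<in> F"
  have "basis_coeff e s (\<Sum>s\<in>F. c s *\<^sub>R e s) = 0"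
    unfolding assms(3) by (rule linear_0[OF linear_basis_coeff[OF e]])
  then have "(\<Sum>t\<in>F. c t * (if s = t then 1 else 0)) = 0"
    by (simp add: linear_sum[OF linear_basis_coeff[OF e]]
        linear_scale[OF linear_basis_coeff[OF e]] basis_coeff_basis[OF e])
  then show "c s = 0" using s assms(2) by (simp add: if_distrib cong: if_cong)
qed

lemma swapped_free:
  "free_datum \<alpha> \<beta> B \<alpha>' \<beta>' B' \<Longrightarrow>
    free_datum \<beta> \<alpha> (\<lambda>y x. B x y) \<beta>' \<alpha>' (\<lambda>y x. B' x y)"
  by (simp add: free_datum_def bilinear_def)

lemma swapped_standard:
  "standard_realization \<alpha> \<beta> B \<gamma> G \<Longrightarrow> standard_realization \<beta> \<alpha> (\<lambda>y x. B x y) \<gamma> G"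
  by (simp add: standard_realization_def mult.commute)

context comparison
begin

lemma swapped_comparison:
  "comparison m \<beta> \<alpha> (\<lambda>y x. B x y) \<beta>' \<alpha>' (\<lambda>y x. B' x y) \<gamma> G"
  by (intro comparison.intro swapped_datum
      swapped_free[OF free_datum_axioms] swapped_standard[OF standard_realization_axioms])

lemma datum_free: "coxeter_datum m \<alpha>' \<beta>' B'"
proof
  show "\<And>F c. finite F \<Longrightarrow> (\<Sum>s\<in>F. c s *\<^sub>R \<alpha>' s) = 0 \<Longrightarrow> \<forall>s\<in>F. c s = 0"
    by (rule basis_positively_independent[OF basis1])
  show "\<And>F c. finite F \<Longrightarrow> (\<Sum>s\<in>F. c s *\<^sub>R \<beta>' s) = 0 \<Longrightarrow> \<forall>s\<in>F. c s = 0"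
    by (rule basis_positively_independent[OF basis2])
qed (simp_all add: pairing matrix bilinear' C1 C2 C3_finite C3_infinite C4)

lemma datum_standard: "coxeter_datum m \<gamma> \<gamma> G"
proof
  have sq: "G (\<gamma> s) (\<gamma> t) * G (\<gamma> t) (\<gamma> s) = B (\<alpha> s) (\<beta> t) * B (\<alpha> t) (\<beta> s)" for s t
    using square[of s t] symmetric[of "\<gamma> s" "\<gamma> t"] by (simp add: power2_eq_square)
  show "\<And>s t k. m s t = enat k \<Longrightarrow> G (\<gamma> s) (\<gamma> t) * G (\<gamma> t) (\<gamma> s) = (cos (pi / real k))\<^sup>2"
    by (simp add: sq C3_finite)
  show "\<And>s t. m s t = \<infinity> \<Longrightarrow> \<exists>c\<ge>1. G (\<gamma> s) (\<gamma> t) * G (\<gamma> t) (\<gamma> s) = c\<^sup>2"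
    by (simp add: sq C3_infinite)
  show "\<And>s t. (G (\<gamma> s) (\<gamma> t) = 0) = (G (\<gamma> t) (\<gamma> s) = 0)" by (simp add: symmetric)
  show "\<And>F c. finite F \<Longrightarrow> (\<Sum>s\<in>F. c s *\<^sub>R \<gamma> s) = 0 \<Longrightarrow> \<forall>s\<in>F. c s = 0"
    by (rule basis_positively_independent[OF basis])
qed (simp_all add: matrix bilinear_G unit nonpos)

end

sublocale comparison \<subseteq> dual: coxeter_datum m \<beta> \<alpha> "\<lambda>y x. B x y"
  by (rule swapped_datum)

sublocale comparison \<subseteq> free: coxeter_datum m \<alpha>' \<beta>' B'
  by (rule datum_free)

sublocale comparison \<subseteq> dual_free: coxeter_datum m \<beta>' \<alpha>' "\<lambda>y x. B' x y"
  by (rule free.swapped_datum)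

sublocale comparison \<subseteq> std: coxeter_datum m \<gamma> \<gamma> G
  by (rule datum_standard)

context comparison
begin

lemma edges: "free.edge = edge" "dual_free.edge = edge" "std.edge = edge"
  using square symmetric
  by (auto simp: fun_eq_iff free.edge_def dual_free.edge_def std.edge_def edge_def pairing
      power2_eq_square mult.commute)

text \<open>
  Both terms of the rank two expansion enter with non-negative factors, and the factors \<open>\<kappa>\<close> and
  \<open>1 / \<kappa>\<close> cancel in the product of the first two coefficients.
\<close>

lemma reduced_dominates:
  assumes "reduced m (w @ [s])"
  shows "dominates (basis_coeff \<alpha>' i (free.act w (\<alpha>' s)))
    (basis_coeff \<beta>' i (dual_free.act w (\<beta>' s))) (basis_coeff \<gamma> i (std.act w (\<gamma> s)))"
  using assms
proof (induction w arbitrary: s rule: length_induct)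
  case (1 w)
  let ?D = "\<lambda>v x. dominates (basis_coeff \<alpha>' i (free.act v (\<alpha>' x)))
    (basis_coeff \<beta>' i (dual_free.act v (\<beta>' x))) (basis_coeff \<gamma> i (std.act v (\<gamma> x)))"
  show ?case
  proof (cases "w = []")
    case True
    then show ?thesis
      by (simp add: dominates_def basis_coeff_basis[OF basis1] basis_coeff_basis[OF basis2]
          basis_coeff_basis[OF basis])
  next
    case False
    obtain t v d where ts: "t \<noteq> s" and w: "coxeter_eq m w (v @ d)" and len: "length v < length w"
      and red: "reduced m (v @ [s])" "reduced m (v @ [t])" "set d \<subseteq> {s, t}" "reduced m (d @ [s])"
      using parabolic_decomposition[OF "1.prems" False] .
    have IH: "?D v s" "?D v t" using "1.IH" len red by auto
    define n where "n = length d"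
    have d: "d = alternating s t n"
      unfolding n_def by (rule reduced_dihedral_alternating[OF red(3,4)])
    obtain \<kappa> where \<kappa>: "0 < \<kappa>" "B (\<alpha> s) (\<beta> t) = - edge s t * \<kappa>" "B (\<alpha> t) (\<beta> s) = - edge s t / \<kappa>"
      using edge_scaling[of s t] ts by blast
    \<comment> \<open>The coefficients of \<open>d \<gamma>\<^sub>s\<close>; in the other two realizations the second one is multiplied
      by \<open>\<kappa>\<close> or by its inverse.\<close>
    define p where "p = cheb (edge s t) (if even n then Suc n else n)"
    define q where "q = cheb (edge s t) (if even n then n else Suc n)"
    have pq: "0 \<le> p" "0 \<le> q"
      using cheb_edge_nonneg[of s t n] ts red(4) d by (auto simp: p_def q_def)
    have G: "G (\<gamma> s) (\<gamma> t) = - edge s t"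
    proof -
      have "edge s t = sqrt ((G (\<gamma> s) (\<gamma> t))\<^sup>2)" by (simp add: edge_def square)
      then show ?thesis using nonpos[of s t] ts by simp
    qed
    have "free.act d (\<alpha>' s) = p *\<^sub>R \<alpha>' s + (q * \<kappa>) *\<^sub>R \<alpha>' t"
      using free.act_alternating[where \<kappa> = \<kappa> and s = s and t = t and n = n] \<kappa>
      by (simp add: d p_def q_def pairing edges)
    then have 1: "free.act w (\<alpha>' s) = p *\<^sub>R free.act v (\<alpha>' s) + (q * \<kappa>) *\<^sub>R free.act v (\<alpha>' t)"
      by (simp add: free.act_cong[OF w] linear_add[OF free.linear_act]
          linear_scale[OF free.linear_act])
    have "dual_free.act d (\<beta>' s) = p *\<^sub>R \<beta>' s + (q / \<kappa>) *\<^sub>R \<beta>' t"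
      using dual_free.act_alternating[where \<kappa> = "1 / \<kappa>" and s = s and t = t and n = n] \<kappa>
      by (simp add: d p_def q_def pairing edges)
    then have 2: "dual_free.act w (\<beta>' s)
        = p *\<^sub>R dual_free.act v (\<beta>' s) + (q / \<kappa>) *\<^sub>R dual_free.act v (\<beta>' t)"
      by (simp add: dual_free.act_cong[OF w] linear_add[OF dual_free.linear_act]
          linear_scale[OF dual_free.linear_act])
    have "std.act d (\<gamma> s) = p *\<^sub>R \<gamma> s + q *\<^sub>R \<gamma> t"
      using std.act_alternating[where \<kappa> = 1 and s = s and t = t and n = n] G
      by (simp add: d p_def q_def symmetric edges)
    then have 3: "std.act w (\<gamma> s) = p *\<^sub>R std.act v (\<gamma> s) + q *\<^sub>R std.act v (\<gamma> t)"
      by (simp add: std.act_cong[OF w] linear_add[OF std.linear_act] linear_scale[OF std.linear_act])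
    show ?thesis
      using dominates_add[OF dominates_scale[OF IH(1) pq(1), of 1]
          dominates_scale[OF IH(2) pq(2) \<kappa>(1)]]
      by (simp add: 1 2 3 linear_add[OF linear_basis_coeff[OF basis1]]
          linear_scale[OF linear_basis_coeff[OF basis1]] linear_add[OF linear_basis_coeff[OF basis2]]
          linear_scale[OF linear_basis_coeff[OF basis2]] linear_add[OF linear_basis_coeff[OF basis]]
          linear_scale[OF linear_basis_coeff[OF basis]])
  qed
qed

text \<open>
  One sign serves all coordinates and all three realizations: it is positive exactly when \<open>w s\<close> is
  longer than \<open>w\<close>.
\<close>

lemma roots_signed:
  "\<exists>\<epsilon>::real. (\<epsilon> = 1 \<or> \<epsilon> = - 1) \<and>
    (\<forall>i. dominates (\<epsilon> * basis_coeff \<alpha>' i (free.act w (\<alpha>' s)))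
      (\<epsilon> * basis_coeff \<beta>' i (dual_free.act w (\<beta>' s))) (\<epsilon> * basis_coeff \<gamma> i (std.act w (\<gamma> s))))"
proof -
  obtain v where v: "coxeter_eq m w v" "reduced m v" using ex_reduced by blast
  show ?thesis
  proof (cases "reduced m (v @ [s])")
    case True
    show ?thesis
      using reduced_dominates[OF True]
      by (intro exI[of _ 1])
        (simp_all add: free.act_cong[OF v(1)] dual_free.act_cong[OF v(1)] std.act_cong[OF v(1)])
  next
    case False
    obtain v' where v': "coxeter_eq m v (v' @ [s])" "reduced m (v' @ [s])"
      using descent[OF v(2) False] .
    note eq = coxeter_eq.trans[OF v(1) v'(1)]
    show ?thesis
      using reduced_dominates[OF v'(2)]
      by (intro exI[of _ "- 1"])
        (simp_all add: free.act_cong[OF eq] dual_free.act_cong[OF eq] std.act_cong[OF eq]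
          free.refl1_simple dual_free.refl1_simple std.refl1_simple
          linear_neg[OF free.linear_act] linear_neg[OF dual_free.linear_act]
          linear_neg[OF std.linear_act]
          linear_neg[OF linear_basis_coeff[OF basis1]] linear_neg[OF linear_basis_coeff[OF basis2]]
          linear_neg[OF linear_basis_coeff[OF basis]])
  qed
qed

lemma coeff_inequality:
  "(basis_coeff \<gamma> i (std.act w (\<gamma> s)))\<^sup>2
    \<le> basis_coeff \<alpha>' i (free.act w (\<alpha>' s)) * basis_coeff \<beta>' i (dual_free.act w (\<beta>' s))"
proof -
  obtain \<epsilon> :: real where \<epsilon>: "\<epsilon> = 1 \<or> \<epsilon> = - 1"
    and "\<And>i. dominates (\<epsilon> * basis_coeff \<alpha>' i (free.act w (\<alpha>' s)))
      (\<epsilon> * basis_coeff \<beta>' i (dual_free.act w (\<beta>' s))) (\<epsilon> * basis_coeff \<gamma> i (std.act w (\<gamma> s)))"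
    using roots_signed[of w s] by blast
  from this(2)[of i] show ?thesis using \<epsilon> by (auto simp: dominates_def)
qed

text \<open>
  By comparison of coefficients, \<open>w \<beta>'\<^sub>s\<close> and \<open>w \<gamma>\<^sub>s\<close> are non-negative multiples of \<open>\<beta>'\<^sub>t\<close> and
  \<open>\<gamma>\<^sub>t\<close>; invariance of the pairing and of the form makes both factors equal to 1.
\<close>

lemma free_fixed_transfer:
  assumes fixed: "free.act w (\<alpha>' s) = \<alpha>' t"
  shows "dual_free.act w (\<beta>' s) = \<beta>' t" and "std.act w (\<gamma> s) = \<gamma> t"
proof -
  obtain \<epsilon> :: real where \<epsilon>: "\<epsilon> = 1 \<or> \<epsilon> = - 1"
    and dom: "\<And>i. dominates (\<epsilon> * basis_coeff \<alpha>' i (free.act w (\<alpha>' s)))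
      (\<epsilon> * basis_coeff \<beta>' i (dual_free.act w (\<beta>' s))) (\<epsilon> * basis_coeff \<gamma> i (std.act w (\<gamma> s)))"
    using roots_signed[of w s] by blast
  have "0 \<le> \<epsilon>" using dom[of t] by (simp add: dominates_def fixed basis_coeff_basis[OF basis1])
  with \<epsilon> have dom: "dominates (if i = t then 1 else 0)
      (basis_coeff \<beta>' i (dual_free.act w (\<beta>' s))) (basis_coeff \<gamma> i (std.act w (\<gamma> s)))" for i
    using dom[of i] by (auto simp: fixed basis_coeff_basis[OF basis1])
  define b where "b = basis_coeff \<beta>' t (dual_free.act w (\<beta>' s))"
  define c where "c = basis_coeff \<gamma> t (std.act w (\<gamma> s))"
  have off: "basis_coeff \<beta>' i (dual_free.act w (\<beta>' s)) = 0" "basis_coeff \<gamma> i (std.act w (\<gamma> s)) = 0"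
    if "i \<noteq> t" for i
    using dom[of i] that by (auto simp: dominates_def)
  have b: "dual_free.act w (\<beta>' s) = b *\<^sub>R \<beta>' t"
    unfolding b_def by (rule basis_line[OF basis2 off(1)])
  have c: "std.act w (\<gamma> s) = c *\<^sub>R \<gamma> t"
    unfolding c_def by (rule basis_line[OF basis off(2)])
  have "B' (free.act w (\<alpha>' s)) (dual_free.act w (\<beta>' s)) = 1"
    using free.B_invariant[of w "\<alpha>' s" "\<beta>' s"] by (simp add: refl2_eq_refl1 free.C1)
  then have "b = 1" by (simp add: fixed b bilinear_rmul[OF bilinear'] free.C1)
  then show "dual_free.act w (\<beta>' s) = \<beta>' t" by (simp add: b)
  have "refl2 \<gamma> \<gamma> G = refl1 \<gamma> \<gamma> G" by (intro ext) (simp add: refl1_def refl2_def symmetric)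
  then have "G (std.act w (\<gamma> s)) (std.act w (\<gamma> s)) = 1"
    using std.B_invariant[of w "\<gamma> s" "\<gamma> s"] by (simp add: unit)
  then have "c\<^sup>2 = 1"
    by (simp add: c bilinear_rmul[OF bilinear_G] bilinear_lmul[OF bilinear_G] unit power2_eq_square)
  moreover have "0 \<le> c" using dom[of t] by (simp add: c_def dominates_def)
  ultimately have "c = 1" by (simp add: power2_eq_1_iff)
  then show "std.act w (\<gamma> s) = \<gamma> t" by (simp add: c)
qed

section \<open>Lifting roots to the free datum\<close>

lemma projection_root: "linear_map_of \<alpha>' \<alpha> (free.act w (\<alpha>' s)) = act w (\<alpha> s)"
proof -
  let ?\<pi> = "linear_map_of \<alpha>' \<alpha>"
  note lin = linear_map_of_basis(1)[OF basis1, of \<alpha>]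
    and val = linear_map_of_basis(2)[OF basis1, of \<alpha>]
  have "B (?\<pi> x) (\<beta> t) = B' x (\<beta>' t)" for x t
  proof -
    have "linear (\<lambda>x. B (?\<pi> x) (\<beta> t))" "linear (\<lambda>x. B' x (\<beta>' t))"
      by (auto intro!: linearI simp: linear_add[OF lin] linear_scale[OF lin]
          bilinear_ladd[OF bilinear] bilinear_lmul[OF bilinear]
          bilinear_ladd[OF bilinear'] bilinear_lmul[OF bilinear'])
    then show ?thesis
      by (rule linear_eq_on[where B = "range \<alpha>'"])
        (use basis1 in \<open>auto simp: indexed_basis_def val pairing\<close>)
  qed
  then have "?\<pi> (refl1 \<alpha>' \<beta>' B' t x) = refl1 \<alpha> \<beta> B t (?\<pi> x)" for t x
    by (simp add: refl1_def linear_diff[OF lin] linear_scale[OF lin] val)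
  then show ?thesis by (induction w) (simp_all add: val)
qed

text \<open>
  Positivity replaces linear independence of the simple roots: a combination of simple roots with
  coefficients of one sign that is equal to a simple root \<open>\<alpha>\<^sub>t\<close> is trivial. Negative coefficients
  would give a vanishing positive combination; for non-negative ones, the coefficient of \<open>\<alpha>\<^sub>t\<close> is
  at least 1, and subtracting \<open>\<alpha>\<^sub>t\<close> leaves a vanishing non-negative combination.
\<close>

lemma free_fixed_of_fixed:
  assumes fixed: "act w (\<alpha> s) = \<alpha> t"
  shows "free.act w (\<alpha>' s) = \<alpha>' t"
proof -
  define c where "c i = basis_coeff \<alpha>' i (free.act w (\<alpha>' s))" for i
  note lin = linear_map_of_basis(1)[OF basis1, of \<alpha>]
    and val = linear_map_of_basis(2)[OF basis1, of \<alpha>]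
  define F where "F = insert t {i. c i \<noteq> 0}"
  have fin: "finite F" using basis_expansion(1)[OF basis1] by (simp add: F_def c_def)
  have "(\<Sum>i\<in>F. c i *\<^sub>R \<alpha>' i) = (\<Sum>i | c i \<noteq> 0. c i *\<^sub>R \<alpha>' i)"
    by (rule sum.mono_neutral_right[OF fin]) (auto simp: F_def)
  also have "\<dots> = free.act w (\<alpha>' s)" unfolding c_def by (rule basis_expansion(2)[OF basis1])
  finally have "linear_map_of \<alpha>' \<alpha> (\<Sum>i\<in>F. c i *\<^sub>R \<alpha>' i) = \<alpha> t"
    by (simp add: projection_root fixed)
  then have sum: "(\<Sum>i\<in>F. c i *\<^sub>R \<alpha> i) = \<alpha> t"
    by (simp add: linear_sum[OF lin] linear_scale[OF lin] val)
  obtain \<epsilon> :: real where \<epsilon>: "\<epsilon> = 1 \<or> \<epsilon> = - 1" and "\<And>i. dominates (\<epsilon> * c i)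
      (\<epsilon> * basis_coeff \<beta>' i (dual_free.act w (\<beta>' s))) (\<epsilon> * basis_coeff \<gamma> i (std.act w (\<gamma> s)))"
    unfolding c_def using roots_signed[of w s] by blast
  then have sgn: "0 \<le> \<epsilon> * c i" for i by (auto simp: dominates_def)
  have split: "(\<Sum>i\<in>F. (c i - (if i = t then 1 else 0)) *\<^sub>R \<alpha> i) = 0"
  proof -
    have "(\<Sum>i\<in>F. (if i = t then 1 else 0) *\<^sub>R \<alpha> i) = (\<Sum>i\<in>F. if i = t then \<alpha> i else 0)"
      by (intro sum.cong) auto
    also have "\<dots> = \<alpha> t" using fin by (simp add: F_def)
    finally show ?thesis by (simp add: scaleR_left_diff_distrib sum_subtractf sum)
  qed
  have "\<epsilon> = 1"
  proof (rule ccontr)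
    assume "\<epsilon> \<noteq> 1"
    then have neg: "c i \<le> 0" for i using sgn[of i] \<epsilon> by auto
    have "(\<Sum>i\<in>F. ((if i = t then 1 else 0) - c i) *\<^sub>R \<alpha> i) = 0"
      using arg_cong[OF split, of uminus] by (simp add: sum_negf[symmetric] scaleR_left_diff_distrib)
    moreover have "\<forall>i\<in>F. 0 \<le> (if i = t then 1 else 0) - c i" 
      using neg by (simp add: order_trans[OF neg])
    ultimately have "\<forall>i\<in>F. (if i = t then 1 else 0) - c i = 0" by (intro C5_1[OF fin])
    then show False using neg[of t] by (simp add: F_def)
  qed
  with sgn have pos: "0 \<le> c i" for i by (metis mult_1)
  \<comment> \<open>Pairing with \<open>\<beta>\<^sub>t\<close> bounds the coefficient of \<open>\<alpha>\<^sub>t\<close> from below, because the other simple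
    roots pair non-positively.\<close>
  have "B (\<Sum>i\<in>F. c i *\<^sub>R \<alpha> i) (\<beta> t) = (\<Sum>i\<in>F. c i * B (\<alpha> i) (\<beta> t))"
  proof -
    have "linear (\<lambda>x. B x (\<beta> t))" using bilinear by (simp add: bilinear_def)
    from linear_sum[OF this, of "\<lambda>i. c i *\<^sub>R \<alpha> i" F] show ?thesis
      by (simp add: bilinear_lmul[OF bilinear])
  qed
  then have "1 = (\<Sum>i\<in>F. c i * B (\<alpha> i) (\<beta> t))" by (simp add: sum C1)
  also have "\<dots> \<le> (\<Sum>i\<in>F. if i = t then c i else 0)"
    using pos C2 by (intro sum_mono) (auto simp: C1 mult_nonneg_nonpos)
  also have "\<dots> = c t" using fin by (simp add: F_def)
  finally have "1 \<le> c t" .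
  with pos have "\<forall>i\<in>F. 0 \<le> c i - (if i = t then 1 else 0)" by simp
  from C5_1[OF fin this split] have eq: "c i = (if i = t then 1 else 0)" if "i \<in> F" for i
    using that by fastforce
  show ?thesis
  proof (rule basis_coeff_eqI[OF basis1])
    fix i
    show "basis_coeff \<alpha>' i (free.act w (\<alpha>' s)) = basis_coeff \<alpha>' i (\<alpha>' t)"
      using eq[of i]
      by (cases "i \<in> F") (auto simp: c_def[symmetric] F_def basis_coeff_basis[OF basis1])
  qed
qed

lemma fixed_transfer:
  assumes "act w (\<alpha> s) = \<alpha> t"
  shows "dual.act w (\<beta> s) = \<beta> t"
proof -
  have "dual_free.act w (\<beta>' s) = \<beta>' t"
    by (rule free_fixed_transfer(1)[OF free_fixed_of_fixed[OF assms]])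
  then show ?thesis
    using comparison.projection_root[OF swapped_comparison, of w s]
    by (simp add: linear_map_of_basis(2)[OF basis2])
qed

lemma fixed_iff: "act w (\<alpha> s) = \<alpha> t \<longleftrightarrow> dual.act w (\<beta> s) = \<beta> t"
  by (rule iffI[OF fixed_transfer comparison.fixed_transfer[OF swapped_comparison]])

text \<open>
  Two lifts of the same root differ by an element that carries one simple root to another, hence
  they agree.
\<close>

lemma coeff1_root:
  "coeff1 m \<alpha> \<alpha>' \<beta>' B' i (act w (\<alpha> s)) = basis_coeff \<alpha>' i (free.act w (\<alpha>' s))"
proof -
  have "(THE z'. z' \<in> Phi1 m \<alpha>' \<beta>' B' \<and> linear_map_of \<alpha>' \<alpha> z' = act w (\<alpha> s)) = free.act w (\<alpha>' s)"
  proof (rule the_equality)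
    fix z' assume z': "z' \<in> Phi1 m \<alpha>' \<beta>' B' \<and> linear_map_of \<alpha>' \<alpha> z' = act w (\<alpha> s)"
    then obtain v t where v: "z' = free.act v (\<alpha>' t)" unfolding free.Phi1_eq by blast
    then have "act (rev w @ v) (\<alpha> t) = \<alpha> s"
      using z' unfolding act_eq_iff[symmetric] by (simp add: projection_root)
    then show "z' = free.act w (\<alpha>' s)"
      unfolding v free.act_eq_iff by (rule free_fixed_of_fixed)
  qed (use projection_root free.Phi1_eq in auto)
  then show ?thesis by (simp add: coeff1_def)
qed

lemma coeff2_root:
  "coeff2 m \<beta> \<alpha>' \<beta>' B' i (dual.act w (\<beta> s)) = basis_coeff \<beta>' i (dual_free.act w (\<beta>' s))"
proof -
  have "coeff2 m \<beta> \<alpha>' \<beta>' B' = coeff1 m \<beta> \<beta>' \<alpha>' (\<lambda>y x. B' x y)"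
    by (intro ext) (simp add: coeff1_def coeff2_def Phi1_def Phi2_def refl2_eq_refl1)
  then show ?thesis using comparison.coeff1_root[OF swapped_comparison] by simp
qed

end

section \<open>Equivariant maps between root systems\<close>

definition equivariant ::
    "('s \<Rightarrow> 's \<Rightarrow> enat) \<Rightarrow> ('s \<Rightarrow> 'v \<Rightarrow> 'v) \<Rightarrow> ('s \<Rightarrow> 'w \<Rightarrow> 'w) \<Rightarrow> 'v set \<Rightarrow> ('v \<Rightarrow> 'w) \<Rightarrow> bool" where
  "equivariant m f g X F \<longleftrightarrow> (\<forall>w\<in>carrier (coxeter_group m). \<forall>x\<in>X.
    F (coxeter_act f w x) = coxeter_act g w (F x))"

text \<open>
  An equivariant map on a root system is determined by its values on simple roots, and it exists as
  soon as each coincidence \<open>w a\<^sub>s = a\<^sub>t\<close> persists in the target.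
\<close>

lemma equivariant_map:
  assumes X: "coxeter_datum m a b P" and Y: "coxeter_datum m a' b' Q"
    and wd: "\<And>w s t. foldr (refl1 a b P) w (a s) = a t \<Longrightarrow> foldr (refl1 a' b' Q) w (a' s) = a' t"
  shows "\<exists>F \<in> Phi1 m a b P \<rightarrow>\<^sub>E Phi1 m a' b' Q.
    equivariant m (refl1 a b P) (refl1 a' b' Q) (Phi1 m a b P) F \<and>
    (\<forall>u s. F (foldr (refl1 a b P) u (a s)) = foldr (refl1 a' b' Q) u (a' s)) \<and>
    (\<forall>f \<in> extensional (Phi1 m a b P).
      equivariant m (refl1 a b P) (refl1 a' b' Q) (Phi1 m a b P) f \<and> (\<forall>s. f (a s) = a' s) \<longrightarrow> f = F)"
proof -
  interpret X: coxeter_datum m a b P by (rule X)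
  interpret Y: coxeter_datum m a' b' Q by (rule Y)
  have carr: "carrier (coxeter_group m) = range (\<lambda>u. coxeter_rel m `` {u})"
    by (auto simp: coxeter_group_def quotient_def)
  define F where "F = restrict
    (\<lambda>x. SOME y. \<exists>u s. x = X.act u (a s) \<and> y = Y.act u (a' s)) (Phi1 m a b P)"
  have val: "F (X.act u (a s)) = Y.act u (a' s)" for u s
  proof -
    have "X.act u (a s) \<in> Phi1 m a b P" unfolding X.Phi1_eq by blast
    moreover have "(SOME y. \<exists>v t. X.act u (a s) = X.act v (a t) \<and> y = Y.act v (a' t))
        = Y.act u (a' s)"
    proof (rule some_equality)
      fix y assume "\<exists>v t. X.act u (a s) = X.act v (a t) \<and> y = Y.act v (a' t)"
      then obtain v t where vt: "X.act u (a s) = X.act v (a t)" "y = Y.act v (a' t)" by blast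
      from vt(1) have "Y.act u (a' s) = Y.act v (a' t)"
        unfolding X.act_eq_iff Y.act_eq_iff by (rule wd)
      then show "y = Y.act u (a' s)" by (simp only: vt(2))
    qed blast
    ultimately show ?thesis by (simp add: F_def)
  qed
  have "F x \<in> Phi1 m a' b' Q" if "x \<in> Phi1 m a b P" for x
    using that val unfolding X.Phi1_eq Y.Phi1_eq by auto
  then have F: "F \<in> Phi1 m a b P \<rightarrow>\<^sub>E Phi1 m a' b' Q" by (auto simp: F_def)
  have equiv: "equivariant m (refl1 a b P) (refl1 a' b' Q) (Phi1 m a b P) F"
    unfolding equivariant_def
  proof (intro ballI)
    fix w x assume "w \<in> carrier (coxeter_group m)" "x \<in> Phi1 m a b P"
    then obtain v u s where "w = coxeter_rel m `` {v}" "x = X.act u (a s)"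
      unfolding X.Phi1_eq carr by blast
    then show "F (coxeter_act (refl1 a b P) w x) = coxeter_act (refl1 a' b' Q) w (F x)"
      using val[of "v @ u" s] by (simp add: X.coxeter_act_class Y.coxeter_act_class val)
  qed
  have uniq: "f = F"
    if ext: "f \<in> extensional (Phi1 m a b P)"
      and equiv: "equivariant m (refl1 a b P) (refl1 a' b' Q) (Phi1 m a b P) f"
      and simple: "\<forall>s. f (a s) = a' s" for f
  proof (rule extensionalityI[OF ext])
    show "F \<in> extensional (Phi1 m a b P)" by (simp add: F_def)
    fix x assume "x \<in> Phi1 m a b P"
    then obtain u s where x: "x = X.act u (a s)" unfolding X.Phi1_eq by blast
    have "a s \<in> Phi1 m a b P" unfolding X.Phi1_eq by (auto intro!: exI[of _ "[]"] exI[of _ s])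
    then have "f (coxeter_act (refl1 a b P) (coxeter_rel m `` {u}) (a s))
        = coxeter_act (refl1 a' b' Q) (coxeter_rel m `` {u}) (f (a s))"
      using equiv by (simp add: carr equivariant_def)
    then show "f x = F x"
      using simple by (simp add: x val X.coxeter_act_class Y.coxeter_act_class)
  qed
  show ?thesis by (rule bexI[OF _ F]) (use equiv val uniq in blast)
qed

context comparison
begin

lemma phi_root: "phi m \<alpha> \<beta> B (act u (\<alpha> s)) = dual.act u (\<beta> s)"
proof -
  have Phi2: "Phi2 m \<alpha> \<beta> B = Phi1 m \<beta> \<alpha> (\<lambda>y x. B x y)"
    by (simp add: Phi1_def Phi2_def refl2_eq_refl1)
  obtain F where F: "F \<in> Phi1 m \<alpha> \<beta> B \<rightarrow>\<^sub>E Phi1 m \<beta> \<alpha> (\<lambda>y x. B x y)"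
    and equiv: "equivariant m (refl1 \<alpha> \<beta> B) (refl1 \<beta> \<alpha> (\<lambda>y x. B x y)) (Phi1 m \<alpha> \<beta> B) F"
    and val: "\<forall>u s. F (act u (\<alpha> s)) = dual.act u (\<beta> s)"
    and uniq: "\<forall>f \<in> extensional (Phi1 m \<alpha> \<beta> B).
      equivariant m (refl1 \<alpha> \<beta> B) (refl1 \<beta> \<alpha> (\<lambda>y x. B x y)) (Phi1 m \<alpha> \<beta> B) f \<and>
      (\<forall>s. f (\<alpha> s) = \<beta> s) \<longrightarrow> f = F"
    using equivariant_map[OF coxeter_datum_axioms dual.coxeter_datum_axioms fixed_transfer]
    by blast
  have simple: "\<forall>s. F (\<alpha> s) = \<beta> s" using val[rule_format, of "[]"] by simp
  have bij: "bij_betw F (Phi1 m \<alpha> \<beta> B) (Phi1 m \<beta> \<alpha> (\<lambda>y x. B x y))"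
  proof (rule bij_betw_imageI)
    show "inj_on F (Phi1 m \<alpha> \<beta> B)"
    proof (rule inj_onI)
      fix x y assume xy: "x \<in> Phi1 m \<alpha> \<beta> B" "y \<in> Phi1 m \<alpha> \<beta> B" "F x = F y"
      then obtain u s v t where "x = act u (\<alpha> s)" "y = act v (\<alpha> t)" unfolding Phi1_eq by blast
      with xy(3) show "x = y" by (simp only: val act_eq_iff dual.act_eq_iff fixed_iff)
    qed
    show "F ` Phi1 m \<alpha> \<beta> B = Phi1 m \<beta> \<alpha> (\<lambda>y x. B x y)"
    proof (intro equalityI)
      show "F ` Phi1 m \<alpha> \<beta> B \<subseteq> Phi1 m \<beta> \<alpha> (\<lambda>y x. B x y)" using F by auto
      show "Phi1 m \<beta> \<alpha> (\<lambda>y x. B x y) \<subseteq> F ` Phi1 m \<alpha> \<beta> B"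
      proof
        fix y assume "y \<in> Phi1 m \<beta> \<alpha> (\<lambda>y x. B x y)"
        then obtain u s where "y = dual.act u (\<beta> s)" unfolding dual.Phi1_eq by blast
        then have "y = F (act u (\<alpha> s))" by (simp only: val)
        moreover have "act u (\<alpha> s) \<in> Phi1 m \<alpha> \<beta> B" unfolding Phi1_eq by blast
        ultimately show "y \<in> F ` Phi1 m \<alpha> \<beta> B" by (rule image_eqI)
      qed
    qed
  qed
  have "phi m \<alpha> \<beta> B = F"
    unfolding phi_def Phi2 refl2_eq_refl1 equivariant_def[symmetric]
  proof (rule the_equality, intro conjI)
    show "F \<in> extensional (Phi1 m \<alpha> \<beta> B)" using F by (simp add: PiE_iff)
  qed (use bij equiv simple uniq in blast)+
  then show ?thesis by (simp add: val)
qed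

lemma phi_1_root: "phi_1 m \<alpha> \<beta> B \<gamma> G (act u (\<alpha> s)) = std.act u (\<gamma> s)"
proof -
  obtain F where F: "F \<in> Phi1 m \<alpha> \<beta> B \<rightarrow>\<^sub>E Phi1 m \<gamma> \<gamma> G"
    and equiv: "equivariant m (refl1 \<alpha> \<beta> B) (refl1 \<gamma> \<gamma> G) (Phi1 m \<alpha> \<beta> B) F"
    and val: "\<forall>u s. F (act u (\<alpha> s)) = std.act u (\<gamma> s)"
    and uniq: "\<forall>f \<in> extensional (Phi1 m \<alpha> \<beta> B).
      equivariant m (refl1 \<alpha> \<beta> B) (refl1 \<gamma> \<gamma> G) (Phi1 m \<alpha> \<beta> B) f \<and> (\<forall>s. f (\<alpha> s) = \<gamma> s) \<longrightarrow> f = F"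
    using equivariant_map[OF coxeter_datum_axioms std.coxeter_datum_axioms
        free_fixed_transfer(2)[OF free_fixed_of_fixed]]
    by blast
  have simple: "\<forall>s. F (\<alpha> s) = \<gamma> s" using val[rule_format, of "[]"] by simp
  have "phi_1 m \<alpha> \<beta> B \<gamma> G = F"
    unfolding phi_1_def equivariant_def[symmetric]
  proof (rule the_equality, intro conjI)
    show "F \<in> Phi1 m \<alpha> \<beta> B \<rightarrow>\<^sub>E Phi1 m \<gamma> \<gamma> G" by (rule F)
    show "f = F"
      if f: "f \<in> Phi1 m \<alpha> \<beta> B \<rightarrow>\<^sub>E Phi1 m \<gamma> \<gamma> G \<and>
        equivariant m (refl1 \<alpha> \<beta> B) (refl1 \<gamma> \<gamma> G) (Phi1 m \<alpha> \<beta> B) f \<and> (\<forall>s. f (\<alpha> s) = \<gamma> s)" for f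
    proof -
      have "f \<in> extensional (Phi1 m \<alpha> \<beta> B)" using f by (simp add: PiE_iff)
      then show ?thesis using f uniq by blast
    qed
  qed (use equiv simple in blast)+
  then show ?thesis by (simp add: val)
qed

end

theorem proposition4p7:
  fixes m :: "'s \<Rightarrow> 's \<Rightarrow> enat"
    and \<alpha> :: "'s \<Rightarrow> 'a::real_vector"
    and \<beta> :: "'s \<Rightarrow> 'b::real_vector"
    and B :: "'a \<Rightarrow> 'b \<Rightarrow> real"
    and \<alpha>' :: "'s \<Rightarrow> 'c::real_vector"
    and \<beta>' :: "'s \<Rightarrow> 'd::real_vector"
    and B' :: "'c \<Rightarrow> 'd \<Rightarrow> real"
    and \<gamma> :: "'s \<Rightarrow> 'v::real_vector"
    and G :: "'v \<Rightarrow> 'v \<Rightarrow> real"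
    and x :: 'a
    and r :: 's
  assumes "coxeter_datum m \<alpha> \<beta> B"
    and "free_datum \<alpha> \<beta> B \<alpha>' \<beta>' B'"
    and "standard_realization \<alpha> \<beta> B \<gamma> G"
    and "x \<in> Phi1 m \<alpha> \<beta> B"
  shows "coeff1 m \<alpha> \<alpha>' \<beta>' B' r x * coeff2 m \<beta> \<alpha>' \<beta>' B' r (phi m \<alpha> \<beta> B x)
           \<ge> (basis_coeff \<gamma> r (phi_1 m \<alpha> \<beta> B \<gamma> G x))\<^sup>2"
proof -
  interpret comparison m \<alpha> \<beta> B \<alpha>' \<beta>' B' \<gamma> G
    using assms(1-3) by (rule comparison.intro)
  obtain u s where x: "x = act u (\<alpha> s)" using assms(4) unfolding Phi1_eq by blast
  show ?thesis
    using coeff_inequality[of r u s]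
    by (simp only: x phi_root phi_1_root coeff1_root coeff2_root)
qed

end
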